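(* Let $\mathsf{k}$ be a field, $(E,w)$ a row-finite weighted graph, and $H$ a hereditary and saturated subset of $E^0$. Let $I(H)$ be the ideal of $L_{\mathsf{k}}(E,w)$ generated by $H$. Then: (1) There exists an isomorphism of $\mathsf{k}$-algebras $\bar{\phi}: L_{\mathsf{k}}(E,w)/I(H)\longrightarrow L_{\mathsf{k}}(E/H,w_r)$. (2) $I(H)\cap E^0=H$.
   Context: A (directed) graph is a quadruple $E=(E^0,E^1,s,r)$ with sets $E^0$ (vertices) and $E^1$ (edges) and maps $s,r:E^1\to E^0$ (source, range). It is row-finite if each vertex emits finitely many edges ($s^{-1}(v)$ is finite for all $v$). A vertex is a sink if it emits no edges; it is regular if it is not a sink and emits only finitely many edges; $E^0_{\mathrm{reg}}$ is the set of regular vertices. A weighted graph is a pair $(E,w)$ with $E$ a graph and $w:E^1\to\mathbb{N}^+$ a map ($\mathbb{N}^+$ = positive integers); it is row-finite if $E$ is. For $v\in E^0_{\mathrm{reg}}$ set $w(v):=\max\{w(e): e\in s^{-1}(v)\}$. For a row-finite weighted graph $(E,w)$ and a field $\mathsf{k}$, the weighted Leavitt path algebra $L_{\mathsf{k}}(E,w)$ is the (associative, not necessarily unital) $\mathsf{k}$-algebra generated by $\{v,e_i,e_i^*: v\in E^0, e\in E^1, 1\le i\le w(e)\}$ subject to the relations (i) $uv=\delta_{uv}u$ for $u,v\in E^0$; (ii) $s(e)e_i=e_i=e_ir(e)$ and $r(e)e_i^*=e_i^*=e_i^*s(e)$ for $e\in E^1$, $1\le i\le w(e)$; (iii) $\sum_{e\in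 s^{-1}(v)}e_ie_j^*=\delta_{ij}v$ for $v\in E^0_{\mathrm{reg}}$, $1\le i,j\le w(v)$; (iv) $\sum_{1\le i\le w(v)}e_i^*f_i=\delta_{ef}r(e)$ for $v\in E^0_{\mathrm{reg}}$, $e,f\in s^{-1}(v)$; where in (iii),(iv) $e_i$ and $e_i^*$ are set to be zero whenever $i>w(e)$. Vertices are regarded as elements of $L_{\mathsf{k}}(E,w)$. A subset $H\subseteq E^0$ is hereditary if $s(e)\in H$ implies $r(e)\in H$ for every $e\in E^1$. For $v\in E^0_{\mathrm{reg}}$ and $1\le i\le w(v)$ let $A_{v,i}:=\{e\in s^{-1}(v): w(e)\ge i\}$. A subset $H\subseteq E^0$ is saturated if whenever $v\in E^0_{\mathrm{reg}}$ satisfies $\{r(e): e\in A_{v,i}\}\subseteq H$ for some $1\le i\le w(v)$, then $v\in H$. For hereditary $H$, the quotient graph $E/H$ has vertex set $E^0\setminus H$ and edge set $\{e\in E^1: r(e)\notin H\}$, with source and range maps restricted from $E$; $w_r$ denotes the restriction of $w$ to the edges of $E/H$. *)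

theory Defs
  imports "Graph_Theory.Digraph" "HOL-Library.Poly_Mapping" "HOL.Hull"
begin

section \<open>Associative, not necessarily unital algebras over a field\<close>

text \<open>The rings of HOL-Algebra are unital, whereas Leavitt path algebras of graphs with infinitely
  many vertices are not, so algebras are given by a carrier-based structure of their own.\<close>

record ('k, 'a) nu_algebra =
  alg_carrier :: "'a set"
  alg_zero :: 'a
  alg_add :: "'a \<Rightarrow> 'a \<Rightarrow> 'a"
  alg_mult :: "'a \<Rightarrow> 'a \<Rightarrow> 'a"
  alg_smult :: "'k \<Rightarrow> 'a \<Rightarrow> 'a"

locale nu_algebra =
  fixes A :: "('k::field, 'a) nu_algebra"
  assumes zero_closed: "alg_zero A \<in> alg_carrier A"
    and add_closed: "\<lbrakk>a \<in> alg_carrier A; b \<in> alg_carrier A\<rbrakk> \<Longrightarrow> alg_add A a b \<in> alg_carrier A"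
    and mult_closed: "\<lbrakk>a \<in> alg_carrier A; b \<in> alg_carrier A\<rbrakk> \<Longrightarrow> alg_mult A a b \<in> alg_carrier A"
    and smult_closed: "a \<in> alg_carrier A \<Longrightarrow> alg_smult A x a \<in> alg_carrier A"
    and add_assoc: "\<lbrakk>a \<in> alg_carrier A; b \<in> alg_carrier A; c \<in> alg_carrier A\<rbrakk> \<Longrightarrow>
        alg_add A (alg_add A a b) c = alg_add A a (alg_add A b c)"
    and add_comm: "\<lbrakk>a \<in> alg_carrier A; b \<in> alg_carrier A\<rbrakk> \<Longrightarrow> alg_add A a b = alg_add A b a"
    and add_zero: "a \<in> alg_carrier A \<Longrightarrow> alg_add A (alg_zero A) a = a"
    and add_inverse: "a \<in> alg_carrier A \<Longrightarrow> alg_add A (alg_smult A (- 1) a) a = alg_zero A"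
    and mult_assoc: "\<lbrakk>a \<in> alg_carrier A; b \<in> alg_carrier A; c \<in> alg_carrier A\<rbrakk> \<Longrightarrow>
        alg_mult A (alg_mult A a b) c = alg_mult A a (alg_mult A b c)"
    and distrib_right: "\<lbrakk>a \<in> alg_carrier A; b \<in> alg_carrier A; c \<in> alg_carrier A\<rbrakk> \<Longrightarrow>
        alg_mult A (alg_add A a b) c = alg_add A (alg_mult A a c) (alg_mult A b c)"
    and distrib_left: "\<lbrakk>a \<in> alg_carrier A; b \<in> alg_carrier A; c \<in> alg_carrier A\<rbrakk> \<Longrightarrow>
        alg_mult A a (alg_add A b c) = alg_add A (alg_mult A a b) (alg_mult A a c)"
    and smult_add: "\<lbrakk>a \<in> alg_carrier A; b \<in> alg_carrier A\<rbrakk> \<Longrightarrow>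
        alg_smult A x (alg_add A a b) = alg_add A (alg_smult A x a) (alg_smult A x b)"
    and add_smult: "a \<in> alg_carrier A \<Longrightarrow>
        alg_smult A (x + y) a = alg_add A (alg_smult A x a) (alg_smult A y a)"
    and smult_smult: "a \<in> alg_carrier A \<Longrightarrow>
        alg_smult A (x * y) a = alg_smult A x (alg_smult A y a)"
    and one_smult: "a \<in> alg_carrier A \<Longrightarrow> alg_smult A 1 a = a"
    and smult_mult_left: "\<lbrakk>a \<in> alg_carrier A; b \<in> alg_carrier A\<rbrakk> \<Longrightarrow>
        alg_mult A (alg_smult A x a) b = alg_smult A x (alg_mult A a b)"
    and smult_mult_right: "\<lbrakk>a \<in> alg_carrier A; b \<in> alg_carrier A\<rbrakk> \<Longrightarrow>
        alg_mult A a (alg_smult A x b) = alg_smult A x (alg_mult A a b)"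

definition algebra_iso ::
    "('k, 'a) nu_algebra \<Rightarrow> ('k, 'b) nu_algebra \<Rightarrow> ('a \<Rightarrow> 'b) \<Rightarrow> bool" where
  "algebra_iso A B f \<longleftrightarrow>
     bij_betw f (alg_carrier A) (alg_carrier B) \<and>
     (\<forall>a\<in>alg_carrier A. \<forall>b\<in>alg_carrier A. f (alg_add A a b) = alg_add B (f a) (f b)) \<and>
     (\<forall>a\<in>alg_carrier A. \<forall>b\<in>alg_carrier A. f (alg_mult A a b) = alg_mult B (f a) (f b)) \<and>
     (\<forall>x. \<forall>a\<in>alg_carrier A. f (alg_smult A x a) = alg_smult B x (f a))"

definition alg_ideal :: "('k, 'a) nu_algebra \<Rightarrow> 'a set \<Rightarrow> bool" where
  "alg_ideal A I \<longleftrightarrow>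
     I \<subseteq> alg_carrier A \<and> alg_zero A \<in> I \<and>
     (\<forall>a\<in>I. \<forall>b\<in>I. alg_add A a b \<in> I) \<and>
     (\<forall>x. \<forall>a\<in>I. alg_smult A x a \<in> I) \<and>
     (\<forall>a\<in>alg_carrier A. \<forall>b\<in>I. alg_mult A a b \<in> I \<and> alg_mult A b a \<in> I)"

definition ideal_generated :: "('k, 'a) nu_algebra \<Rightarrow> 'a set \<Rightarrow> 'a set" where
  "ideal_generated A S = alg_ideal A hull S"

definition coset :: "('k, 'a) nu_algebra \<Rightarrow> 'a set \<Rightarrow> 'a \<Rightarrow> 'a set" where
  "coset A I a = alg_add A a ` I"

text \<open>The operations on cosets are those of representatives; for an ideal \<open>I\<close> each of the unions
  below is a union of equal cosets (see the lemmas \<open>quotient_add\<close>, \<open>quotient_mult\<close> and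
  \<open>quotient_smult\<close>).\<close>

definition quotient_algebra ::
    "('k, 'a) nu_algebra \<Rightarrow> 'a set \<Rightarrow> ('k, 'a set) nu_algebra" where
  "quotient_algebra A I =
     \<lparr>alg_carrier = coset A I ` alg_carrier A,
      alg_zero = coset A I (alg_zero A),
      alg_add = (\<lambda>P Q. \<Union>p\<in>P. \<Union>q\<in>Q. coset A I (alg_add A p q)),
      alg_mult = (\<lambda>P Q. \<Union>p\<in>P. \<Union>q\<in>Q. coset A I (alg_mult A p q)),
      alg_smult = (\<lambda>x P. \<Union>p\<in>P. coset A I (alg_smult A x p))\<rparr>"


section \<open>Free algebras\<close>

datatype 'g word = Word (letters: "'g list")

instantiation word :: (type) monoid_add
begin

definition "0 = Word []"
definition "u + v = Word (letters u @ letters v)"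

instance
  by standard (auto simp: zero_word_def plus_word_def)

end

text \<open>With words under concatenation as keys, the convolution product on poly mappings is the
  product of noncommutative polynomials. The free non-unital algebra on \<open>X\<close> consists of those
  without constant term whose words are over \<open>X\<close>.\<close>

type_synonym ('g, 'k) nc_poly = "'g word \<Rightarrow>\<^sub>0 'k"

definition free_algebra :: "'g set \<Rightarrow> ('k::field, ('g, 'k) nc_poly) nu_algebra" where
  "free_algebra X =
     \<lparr>alg_carrier = {p. \<forall>u\<in>Poly_Mapping.keys p. letters u \<noteq> [] \<and> set (letters u) \<subseteq> X},
      alg_zero = 0,
      alg_add = (+),
      alg_mult = (*),
      alg_smult = (\<lambda>x. Poly_Mapping.map ((*) x))\<rparr>"

definition gen :: "'g \<Rightarrow> ('g, 'k::field) nc_poly" where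
  "gen x = Poly_Mapping.single (Word [x]) 1"


section \<open>Weighted graphs\<close>

text \<open>A graph \<open>(E\<^sup>0, E\<^sup>1, s, r)\<close> is a \<^typ>\<open>('v, 'e) pre_digraph\<close> satisfying
  \<^locale>\<open>wf_digraph\<close>, with source map \<^const>\<open>tail\<close> and range map \<^const>\<open>head\<close>. As for these maps,
  only the values of a weight map on \<^term>\<open>arcs E\<close> matter.\<close>

locale row_finite_weighted_graph = wf_digraph E
  for E :: "('v, 'e) pre_digraph" +
  fixes w :: "'e \<Rightarrow> nat"
  assumes row_finite: "v \<in> verts E \<Longrightarrow> finite (out_arcs E v)"
    and weight_pos: "e \<in> arcs E \<Longrightarrow> 0 < w e"

definition regular_verts :: "('v, 'e) pre_digraph \<Rightarrow> 'v set" where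
  "regular_verts E = {v \<in> verts E. out_arcs E v \<noteq> {} \<and> finite (out_arcs E v)}"

definition vertex_weight :: "('v, 'e) pre_digraph \<Rightarrow> ('e \<Rightarrow> nat) \<Rightarrow> 'v \<Rightarrow> nat" where
  "vertex_weight E w v = Max (w ` out_arcs E v)"

definition hereditary :: "('v, 'e) pre_digraph \<Rightarrow> 'v set \<Rightarrow> bool" where
  "hereditary E H \<longleftrightarrow> H \<subseteq> verts E \<and> (\<forall>e\<in>arcs E. tail E e \<in> H \<longrightarrow> head E e \<in> H)"

definition arcs_of_weight_ge ::
    "('v, 'e) pre_digraph \<Rightarrow> ('e \<Rightarrow> nat) \<Rightarrow> 'v \<Rightarrow> nat \<Rightarrow> 'e set" where
  "arcs_of_weight_ge E w v i = {e \<in> out_arcs E v. i \<le> w e}"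

definition saturated :: "('v, 'e) pre_digraph \<Rightarrow> ('e \<Rightarrow> nat) \<Rightarrow> 'v set \<Rightarrow> bool" where
  "saturated E w H \<longleftrightarrow>
     H \<subseteq> verts E \<and>
     (\<forall>v\<in>regular_verts E.
        (\<exists>i\<in>{1..vertex_weight E w v}. head E ` arcs_of_weight_ge E w v i \<subseteq> H) \<longrightarrow> v \<in> H)"

text \<open>The restrictions of the source, range and weight maps to the arcs of \<open>E/H\<close> are represented
  by the same total functions.\<close>

definition quotient_graph :: "('v, 'e) pre_digraph \<Rightarrow> 'v set \<Rightarrow> ('v, 'e) pre_digraph" where
  "quotient_graph E H =
     \<lparr>verts = verts E - H, arcs = {e \<in> arcs E. head E e \<notin> H}, tail = tail E, head = head E\<rparr>"


section \<open>Weighted Leavitt path algebras\<close>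

text \<open>The letters \<open>Real_Edge e i\<close> and \<open>Ghost_Edge e i\<close> stand for \<open>e\<^sub>i\<close> and \<open>e\<^sub>i\<^sup>*\<close>.\<close>

datatype ('v, 'e) letter = Vertex 'v | Real_Edge 'e nat | Ghost_Edge 'e nat

definition wlpa_letters ::
    "('v, 'e) pre_digraph \<Rightarrow> ('e \<Rightarrow> nat) \<Rightarrow> ('v, 'e) letter set" where
  "wlpa_letters E w =
     Vertex ` verts E \<union>
     {Real_Edge e i | e i. e \<in> arcs E \<and> i \<in> {1..w e}} \<union>
     {Ghost_Edge e i | e i. e \<in> arcs E \<and> i \<in> {1..w e}}"

definition vertex_gen :: "'v \<Rightarrow> (('v, 'e) letter, 'k::field) nc_poly" where
  "vertex_gen v = gen (Vertex v)"

text \<open>The convention that \<open>e\<^sub>i\<close> and \<open>e\<^sub>i\<^sup>*\<close> are zero for \<open>i > w(e)\<close> is built in here.\<close>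

definition real_gen :: "('e \<Rightarrow> nat) \<Rightarrow> 'e \<Rightarrow> nat \<Rightarrow> (('v, 'e) letter, 'k::field) nc_poly" where
  "real_gen w e i = (if i \<in> {1..w e} then gen (Real_Edge e i) else 0)"

definition ghost_gen :: "('e \<Rightarrow> nat) \<Rightarrow> 'e \<Rightarrow> nat \<Rightarrow> (('v, 'e) letter, 'k::field) nc_poly" where
  "ghost_gen w e i = (if i \<in> {1..w e} then gen (Ghost_Edge e i) else 0)"

text \<open>A relation \<open>l = r\<close> is represented by the element \<open>l - r\<close> of the free algebra.\<close>

inductive_set wlpa_relators ::
    "('v, 'e) pre_digraph \<Rightarrow> ('e \<Rightarrow> nat) \<Rightarrow> (('v, 'e) letter, 'k::field) nc_poly set"
  for E :: "('v, 'e) pre_digraph" and w :: "'e \<Rightarrow> nat" where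
  vertices: "\<lbrakk>u \<in> verts E; v \<in> verts E\<rbrakk> \<Longrightarrow>
    vertex_gen u * vertex_gen v - (if u = v then vertex_gen u else 0) \<in> wlpa_relators E w"
| real_source: "\<lbrakk>e \<in> arcs E; i \<in> {1..w e}\<rbrakk> \<Longrightarrow>
    vertex_gen (tail E e) * real_gen w e i - real_gen w e i \<in> wlpa_relators E w"
| real_range: "\<lbrakk>e \<in> arcs E; i \<in> {1..w e}\<rbrakk> \<Longrightarrow>
    real_gen w e i * vertex_gen (head E e) - real_gen w e i \<in> wlpa_relators E w"
| ghost_source: "\<lbrakk>e \<in> arcs E; i \<in> {1..w e}\<rbrakk> \<Longrightarrow>
    vertex_gen (head E e) * ghost_gen w e i - ghost_gen w e i \<in> wlpa_relators E w"
| ghost_range: "\<lbrakk>e \<in> arcs E; i \<in> {1..w e}\<rbrakk> \<Longrightarrow>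
    ghost_gen w e i * vertex_gen (tail E e) - ghost_gen w e i \<in> wlpa_relators E w"
| real_ghost: "\<lbrakk>v \<in> regular_verts E; i \<in> {1..vertex_weight E w v}; j \<in> {1..vertex_weight E w v}\<rbrakk> \<Longrightarrow>
    (\<Sum>e\<in>out_arcs E v. real_gen w e i * ghost_gen w e j) - (if i = j then vertex_gen v else 0)
      \<in> wlpa_relators E w"
| ghost_real: "\<lbrakk>v \<in> regular_verts E; e \<in> out_arcs E v; f \<in> out_arcs E v\<rbrakk> \<Longrightarrow>
    (\<Sum>i\<in>{1..vertex_weight E w v}. ghost_gen w e i * real_gen w f i)
      - (if e = f then vertex_gen (head E e) else 0) \<in> wlpa_relators E w"

type_synonym ('v, 'e, 'k) wlpa_elem = "(('v, 'e) letter, 'k) nc_poly set"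

definition wlpa_relation_ideal ::
    "('v, 'e) pre_digraph \<Rightarrow> ('e \<Rightarrow> nat) \<Rightarrow> (('v, 'e) letter, 'k::field) nc_poly set" where
  "wlpa_relation_ideal E w =
     ideal_generated (free_algebra (wlpa_letters E w)) (wlpa_relators E w)"

definition wlpa ::
    "('v, 'e) pre_digraph \<Rightarrow> ('e \<Rightarrow> nat) \<Rightarrow> ('k::field, ('v, 'e, 'k) wlpa_elem) nu_algebra" where
  "wlpa E w = quotient_algebra (free_algebra (wlpa_letters E w)) (wlpa_relation_ideal E w)"

definition wlpa_vertex ::
    "('v, 'e) pre_digraph \<Rightarrow> ('e \<Rightarrow> nat) \<Rightarrow> 'v \<Rightarrow> ('v, 'e, 'k::field) wlpa_elem" where
  "wlpa_vertex E w v =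
     coset (free_algebra (wlpa_letters E w)) (wlpa_relation_ideal E w) (vertex_gen v)"

definition vertex_ideal ::
    "('v, 'e) pre_digraph \<Rightarrow> ('e \<Rightarrow> nat) \<Rightarrow> 'v set \<Rightarrow> ('v, 'e, 'k::field) wlpa_elem set" where
  "vertex_ideal E w H = ideal_generated (wlpa E w) (wlpa_vertex E w ` H)"


section \<open>Well-formedness of the constructions\<close>

lemma UNION_const_eq:
  assumes "a \<in> P" "b \<in> Q" "\<And>p q. \<lbrakk>p \<in> P; q \<in> Q\<rbrakk> \<Longrightarrow> F p q = C"
  shows "(\<Union>p\<in>P. \<Union>q\<in>Q. F p q) = C"
proof
  show "(\<Union>p\<in>P. \<Union>q\<in>Q. F p q) \<subseteq> C"
    by (intro UN_least) (simp only: assms(3) order_refl)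
  have "F a b \<subseteq> (\<Union>p\<in>P. \<Union>q\<in>Q. F p q)"
    using assms(1,2) by blast
  then show "C \<subseteq> (\<Union>p\<in>P. \<Union>q\<in>Q. F p q)"
    by (simp only: assms(3)[OF assms(1,2)])
qed

lemma (in nu_algebra) ideal_generated_ideal:
  assumes "S \<subseteq> alg_carrier A"
  shows "alg_ideal A (ideal_generated A S)"
proof -
  have "alg_ideal A (alg_carrier A)"
    by (simp add: alg_ideal_def zero_closed add_closed mult_closed smult_closed)
  then have carr: "alg_carrier A \<in> {t. alg_ideal A t \<and> S \<subseteq> t}"
    using assms by simp
  have "alg_ideal A (\<Inter>{t. alg_ideal A t \<and> S \<subseteq> t})"
    unfolding alg_ideal_def[of A "\<Inter> _"]
  proof (intro conjI ballI allI)
    show "\<Inter>{t. alg_ideal A t \<and> S \<subseteq> t} \<subseteq> alg_carrier A"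
      using carr by (rule Inter_lower)
  qed (auto simp: alg_ideal_def)
  then show ?thesis
    by (simp add: ideal_generated_def hull_def)
qed

locale nu_algebra_ideal = nu_algebra A for A :: "('k::field, 'a) nu_algebra" +
  fixes I :: "'a set"
  assumes ideal: "alg_ideal A I"
begin

lemma ideal_carrier: "a \<in> I \<Longrightarrow> a \<in> alg_carrier A"
  and ideal_zero: "alg_zero A \<in> I"
  and ideal_add: "\<lbrakk>a \<in> I; b \<in> I\<rbrakk> \<Longrightarrow> alg_add A a b \<in> I"
  and ideal_smult: "a \<in> I \<Longrightarrow> alg_smult A x a \<in> I"
  and ideal_mult_left: "\<lbrakk>a \<in> alg_carrier A; b \<in> I\<rbrakk> \<Longrightarrow> alg_mult A a b \<in> I"
  and ideal_mult_right: "\<lbrakk>b \<in> I; a \<in> alg_carrier A\<rbrakk> \<Longrightarrow> alg_mult A b a \<in> I"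
  using ideal by (auto simp: alg_ideal_def)

lemma add_left_comm:
  assumes "a \<in> alg_carrier A" "b \<in> alg_carrier A" "c \<in> alg_carrier A"
  shows "alg_add A a (alg_add A b c) = alg_add A b (alg_add A a c)"
  using assms by (metis add_assoc add_comm)

lemma coset_shift:
  assumes a: "a \<in> alg_carrier A" and i: "i \<in> I"
  shows "coset A I (alg_add A a i) = coset A I a"
proof -
  have sub: "coset A I (alg_add A b j) \<subseteq> coset A I b" if "b \<in> alg_carrier A" "j \<in> I" for b j
  proof
    fix z assume "z \<in> coset A I (alg_add A b j)"
    then obtain k where "k \<in> I" "z = alg_add A (alg_add A b j) k"
      by (auto simp: coset_def)
    with that have "z = alg_add A b (alg_add A j k)" "alg_add A j k \<in> I"
      by (simp_all add: add_assoc ideal_carrier ideal_add)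
    then show "z \<in> coset A I b" by (auto simp: coset_def)
  qed
  define j where "j = alg_smult A (- 1) i"
  have j: "j \<in> I" using i by (simp add: j_def ideal_smult)
  have "alg_add A (alg_add A a i) j = alg_add A a (alg_add A j i)"
    using a i j by (simp add: add_assoc ideal_carrier add_comm)
  also have "\<dots> = a"
    using a i by (simp add: j_def add_inverse ideal_carrier add_comm[of a] zero_closed add_zero)
  finally have "alg_add A (alg_add A a i) j = a" .
  with sub[of a i] sub[of "alg_add A a i" j] show ?thesis
    using a i j by (simp add: add_closed ideal_carrier)
qed

lemma coset_self: "a \<in> alg_carrier A \<Longrightarrow> a \<in> coset A I a"
  unfolding coset_def using ideal_zero add_zero add_comm zero_closed by (metis imageI)

lemma quotient_add:
  assumes "a \<in> alg_carrier A" "b \<in> alg_carrier A"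
  shows "alg_add (quotient_algebra A I) (coset A I a) (coset A I b) = coset A I (alg_add A a b)"
proof -
  have "coset A I (alg_add A p q) = coset A I (alg_add A a b)"
    if pq: "p \<in> coset A I a" "q \<in> coset A I b" for p q
  proof -
    obtain i j where ij: "i \<in> I" "j \<in> I" "p = alg_add A a i" "q = alg_add A b j"
      using pq by (auto simp: coset_def)
    then have "alg_add A p q = alg_add A (alg_add A a b) (alg_add A i j)"
      using assms by (simp add: add_assoc add_closed ideal_carrier add_left_comm)
    then show ?thesis
      using assms ij by (simp add: coset_shift add_closed ideal_add)
  qed
  then have "(\<Union>p\<in>coset A I a. \<Union>q\<in>coset A I b. coset A I (alg_add A p q)) = coset A I (alg_add A a b)"
    by (intro UNION_const_eq[OF coset_self[OF assms(1)] coset_self[OF assms(2)]])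
  then show ?thesis by (simp add: quotient_algebra_def)
qed

lemma quotient_mult:
  assumes "a \<in> alg_carrier A" "b \<in> alg_carrier A"
  shows "alg_mult (quotient_algebra A I) (coset A I a) (coset A I b) = coset A I (alg_mult A a b)"
proof -
  have "coset A I (alg_mult A p q) = coset A I (alg_mult A a b)"
    if pq: "p \<in> coset A I a" "q \<in> coset A I b" for p q
  proof -
    obtain i j where ij: "i \<in> I" "j \<in> I" "p = alg_add A a i" "q = alg_add A b j"
      using pq by (auto simp: coset_def)
    then have "alg_mult A p q = alg_add A (alg_mult A a b)
        (alg_add A (alg_mult A i b) (alg_add A (alg_mult A a j) (alg_mult A i j)))"
      using assms by (simp add: distrib_left distrib_right add_assoc add_closed mult_closed ideal_carrier)
    then show ?thesis
      using assms ij
      by (simp add: coset_shift mult_closed ideal_add ideal_mult_left ideal_mult_right ideal_carrier)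
  qed
  then have "(\<Union>p\<in>coset A I a. \<Union>q\<in>coset A I b. coset A I (alg_mult A p q)) = coset A I (alg_mult A a b)"
    by (intro UNION_const_eq[OF coset_self[OF assms(1)] coset_self[OF assms(2)]])
  then show ?thesis by (simp add: quotient_algebra_def)
qed

lemma quotient_smult:
  assumes "a \<in> alg_carrier A"
  shows "alg_smult (quotient_algebra A I) x (coset A I a) = coset A I (alg_smult A x a)"
proof -
  have "coset A I (alg_smult A x p) = coset A I (alg_smult A x a)" if p: "p \<in> coset A I a" for p
    using p assms
    by (auto simp: coset_def[of _ _ a] smult_add ideal_carrier smult_closed ideal_smult coset_shift)
  then have "(\<Union>p\<in>coset A I a. \<Union>q\<in>coset A I a. coset A I (alg_smult A x p)) = coset A I (alg_smult A x a)"
    by (intro UNION_const_eq[OF coset_self[OF assms] coset_self[OF assms]])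
  moreover have "coset A I a \<noteq> {}"
    using coset_self[OF assms] by blast
  ultimately show ?thesis by (simp add: quotient_algebra_def)
qed

lemma quotient_nu_algebra: "nu_algebra (quotient_algebra A I)"
proof -
  have carr: "alg_carrier (quotient_algebra A I) = coset A I ` alg_carrier A"
    and zero: "alg_zero (quotient_algebra A I) = coset A I (alg_zero A)"
    by (simp_all add: quotient_algebra_def)
  note ops = carr zero quotient_add quotient_mult quotient_smult
    zero_closed add_closed mult_closed smult_closed
  show ?thesis
  proof (unfold_locales, goal_cases)
    case (6 P Q)
    then show ?case by (auto simp only: ops image_iff add_comm)
  qed (auto simp: ops add_assoc add_zero add_inverse mult_assoc distrib_left distrib_right
         smult_add add_smult smult_smult one_smult smult_mult_left smult_mult_right)
qed

end

lemma map_times_conv_mult: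
  "Poly_Mapping.map ((*) x) p = Poly_Mapping.single 0 x * (p :: ('g, 'k::field) nc_poly)"
proof (rule poly_mapping_eqI)
  fix k :: "'g word"
  have "Poly_Mapping.lookup (Poly_Mapping.single 0 x * p) k
      = (\<Sum>l. (x * (\<Sum>q. Poly_Mapping.lookup p q when k = l + q)) when l = 0)"
    unfolding lookup_mult by (rule Sum_any.cong) (auto simp: lookup_single when_def)
  then show "Poly_Mapping.lookup (Poly_Mapping.map ((*) x) p) k
      = Poly_Mapping.lookup (Poly_Mapping.single 0 x * p) k"
    by (simp add: Poly_Mapping.map.rep_eq when_def)
qed

lemma single_zero_central:
  "p * Poly_Mapping.single 0 x = Poly_Mapping.single 0 x * (p :: ('g, 'k::field) nc_poly)"
proof (rule poly_mapping_eqI)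
  fix k :: "'g word"
  have inner: "(\<Sum>q. Poly_Mapping.lookup (Poly_Mapping.single 0 x) q when k = l + q)
      = (x when l = k)" for l
  proof -
    have "(\<Sum>q. Poly_Mapping.lookup (Poly_Mapping.single 0 x) q when k = l + q)
        = (\<Sum>q :: 'g word. (x when l = k) when q = 0)"
      by (rule Sum_any.cong) (auto simp: lookup_single when_def)
    then show ?thesis by simp
  qed
  have "Poly_Mapping.lookup (p * Poly_Mapping.single 0 x) k
      = (\<Sum>l. (Poly_Mapping.lookup p k * x) when l = k)"
    unfolding lookup_mult inner by (rule Sum_any.cong) (auto simp: when_def)
  then show "Poly_Mapping.lookup (p * Poly_Mapping.single 0 x) k
      = Poly_Mapping.lookup (Poly_Mapping.single 0 x * p) k"
    unfolding map_times_conv_mult[symmetric]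
    by (simp add: Poly_Mapping.map.rep_eq when_def)
qed

lemma free_algebra_nu_algebra: "nu_algebra (free_algebra X :: ('k::field, ('g, 'k) nc_poly) nu_algebra)"
proof -
  have keys_map: "Poly_Mapping.keys (Poly_Mapping.map ((*) x) p) \<subseteq> Poly_Mapping.keys p"
    for x and p :: "('g, 'k) nc_poly"
    by (auto simp: in_keys_iff Poly_Mapping.map.rep_eq)
  show ?thesis
  proof (unfold_locales, goal_cases)
    case (2 a b)
    then show ?case using keys_add[of a b] by (auto simp: free_algebra_def)
  next
    case (3 a b)
    then show ?case using keys_mult[of a b] by (fastforce simp: free_algebra_def plus_word_def)
  next
    case (4 a x)
    then show ?case using keys_map[of x a] by (auto simp: free_algebra_def)
  next
    case (17 a b x)
    have "a * (Poly_Mapping.single 0 x * b) = Poly_Mapping.single 0 x * (a * b)"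
      by (metis mult.assoc single_zero_central)
    then show ?case by (simp add: free_algebra_def map_times_conv_mult)
  next
    case (8 a)
    have "Poly_Mapping.single 0 (- 1) * a + a = 0"
      by (simp add: single_uminus)
    then show ?case by (simp add: free_algebra_def map_times_conv_mult)
  next
    case (14 a x y)
    have "Poly_Mapping.single 0 (x * y) = Poly_Mapping.single 0 x * Poly_Mapping.single (0 :: 'g word) y"
      by (simp add: mult_single)
    then show ?case by (simp add: free_algebra_def map_times_conv_mult mult.assoc)
  next
    case (13 a x y)
    show ?case by (simp add: free_algebra_def map_times_conv_mult single_add distrib_right)
  qed (simp_all add: free_algebra_def map_times_conv_mult add.assoc add.commute mult.assoc
         distrib_left distrib_right)
qed

context row_finite_weighted_graph
begin

lemma vertex_gen_carrier:
  "v \<in> verts E \<Longrightarrow> vertex_gen v \<in> alg_carrier (free_algebra (wlpa_letters E w))"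
  by (auto simp: vertex_gen_def gen_def free_algebra_def wlpa_letters_def)

lemma wlpa_relators_carrier:
  "wlpa_relators E w \<subseteq> alg_carrier (free_algebra (wlpa_letters E w) ::
     ('k::field, (('v, 'e) letter, 'k) nc_poly) nu_algebra)"
proof -
  let ?F = "free_algebra (wlpa_letters E w) :: ('k, (('v, 'e) letter, 'k) nc_poly) nu_algebra"
  interpret F: nu_algebra ?F
    by (rule free_algebra_nu_algebra)
  have ops: "alg_zero ?F = 0" "alg_add ?F = (+)" "alg_mult ?F = (*)"
    by (simp_all add: free_algebra_def)
  note zero = F.zero_closed[unfolded ops]
    and add = F.add_closed[unfolded ops]
    and mult = F.mult_closed[unfolded ops]
  have diff: "p - q \<in> alg_carrier ?F" if "p \<in> alg_carrier ?F" "q \<in> alg_carrier ?F" for p q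
    using that keys_diff[of p q] by (auto simp: free_algebra_def)
  have real: "real_gen w e i \<in> alg_carrier ?F" and ghost: "ghost_gen w e i \<in> alg_carrier ?F"
    if "e \<in> arcs E" for e i
    using that
    by (auto simp: real_gen_def ghost_gen_def gen_def free_algebra_def wlpa_letters_def)
  have sum: "sum f S \<in> alg_carrier ?F" if "\<And>x. x \<in> S \<Longrightarrow> f x \<in> alg_carrier ?F"
    for S and f :: "'x \<Rightarrow> (('v, 'e) letter, 'k) nc_poly"
    using that by (induction S rule: infinite_finite_induct) (auto simp: zero add)
  have if_carr: "(if b then p else 0) \<in> alg_carrier ?F" if "p \<in> alg_carrier ?F" for b p
    using that zero by (cases b) simp_all
  show ?thesis
  proof
    fix p :: "(('v, 'e) letter, 'k) nc_poly"
    assume "p \<in> wlpa_relators E w"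
    then show "p \<in> alg_carrier ?F"
    proof cases
      case (vertices u v)
      show ?thesis unfolding vertices(1) using vertices(2,3)
        by (intro diff mult vertex_gen_carrier if_carr)
    next
      case (real_source e i)
      show ?thesis unfolding real_source(1) using real_source(2)
        by (intro diff mult vertex_gen_carrier real tail_in_verts)
    next
      case (real_range e i)
      show ?thesis unfolding real_range(1) using real_range(2)
        by (intro diff mult vertex_gen_carrier real head_in_verts)
    next
      case (ghost_source e i)
      show ?thesis unfolding ghost_source(1) using ghost_source(2)
        by (intro diff mult vertex_gen_carrier ghost head_in_verts)
    next
      case (ghost_range e i)
      show ?thesis unfolding ghost_range(1) using ghost_range(2)
        by (intro diff mult vertex_gen_carrier ghost tail_in_verts)
    next
      case (real_ghost v i j)
      from real_ghost(2) have "v \<in> verts E" by (simp add: regular_verts_def)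
      then show ?thesis unfolding real_ghost(1)
        by (intro diff sum mult real ghost vertex_gen_carrier if_carr) (simp_all add: out_arcs_def)
    next
      case (ghost_real v e f)
      from ghost_real(3,4) have "e \<in> arcs E" "f \<in> arcs E" by (simp_all add: out_arcs_def)
      then show ?thesis unfolding ghost_real(1)
        by (intro diff sum mult real ghost vertex_gen_carrier if_carr head_in_verts)
    qed
  qed
qed

lemma wlpa_nu_algebra_ideal:
  "nu_algebra_ideal (free_algebra (wlpa_letters E w)) (wlpa_relation_ideal E w ::
     (('v, 'e) letter, 'k::field) nc_poly set)"
  unfolding wlpa_relation_ideal_def
  by (intro nu_algebra_ideal.intro nu_algebra_ideal_axioms.intro free_algebra_nu_algebra
      nu_algebra.ideal_generated_ideal wlpa_relators_carrier)

lemma wlpa_nu_algebra: "nu_algebra (wlpa E w :: ('k::field, ('v, 'e, 'k) wlpa_elem) nu_algebra)"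
  unfolding wlpa_def by (rule nu_algebra_ideal.quotient_nu_algebra[OF wlpa_nu_algebra_ideal])

lemma vertex_nu_algebra_ideal:
  assumes "H \<subseteq> verts E"
  shows "nu_algebra_ideal (wlpa E w) (vertex_ideal E w H :: ('v, 'e, 'k::field) wlpa_elem set)"
  unfolding vertex_ideal_def
proof (intro nu_algebra_ideal.intro nu_algebra_ideal_axioms.intro wlpa_nu_algebra
    nu_algebra.ideal_generated_ideal)
  show "wlpa_vertex E w ` H \<subseteq> alg_carrier (wlpa E w :: ('k, ('v, 'e, 'k) wlpa_elem) nu_algebra)"
    using assms vertex_gen_carrier by (auto simp: wlpa_def quotient_algebra_def wlpa_vertex_def)
qed

end

lemma quotient_graph_row_finite_weighted_graph:
  assumes "row_finite_weighted_graph E w" "hereditary E H"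
  shows "row_finite_weighted_graph (quotient_graph E H) w"
proof -
  interpret row_finite_weighted_graph E w by fact
  show ?thesis
  proof
    fix v assume "v \<in> verts (quotient_graph E H)"
    then have "finite (out_arcs E v)" by (simp add: quotient_graph_def row_finite)
    then show "finite (out_arcs (quotient_graph E H) v)"
      by (rule rev_finite_subset) (auto simp: out_arcs_def quotient_graph_def)
  qed (use assms(2) in \<open>auto simp: quotient_graph_def hereditary_def weight_pos\<close>)
qed

end

theory Submission
  imports Defs
begin

text \<open>Killing the generators of \<open>L(E, w)\<close> that are absent from \<open>E/H\<close> sends the relations of
  \<open>(E, w)\<close> to relations of \<open>(E/H, w\<^sub>r)\<close> or to zero. Saturation enters here: a regular vertex
  outside \<open>H\<close> keeps an edge of maximal weight, hence stays regular of the same weight. Since the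
  killed generators lie in the ideal generated by \<open>H\<close>, the free algebra on the generators of
  \<open>L(E, w)\<close> maps onto \<open>L(E, w)/I(H)\<close> and onto \<open>L(E/H, w\<^sub>r)\<close> with the same kernel. For the
  second claim it then suffices that vertices are nonzero in every weighted Leavitt path algebra,
  which is seen from a representation in which \<open>e\<^sub>i\<close> and \<open>e\<^sub>i\<^sup>*\<close> act through partial injections.\<close>

section \<open>Homomorphisms of algebras\<close>

definition algebra_hom ::
    "('k, 'a) nu_algebra \<Rightarrow> ('k, 'b) nu_algebra \<Rightarrow> ('a \<Rightarrow> 'b) \<Rightarrow> bool" where
  "algebra_hom A B f \<longleftrightarrow>
     f ` alg_carrier A \<subseteq> alg_carrier B \<and>
     (\<forall>a\<in>alg_carrier A. \<forall>b\<in>alg_carrier A. f (alg_add A a b) = alg_add B (f a) (f b)) \<and>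
     (\<forall>a\<in>alg_carrier A. \<forall>b\<in>alg_carrier A. f (alg_mult A a b) = alg_mult B (f a) (f b)) \<and>
     (\<forall>x. \<forall>a\<in>alg_carrier A. f (alg_smult A x a) = alg_smult B x (f a))"

definition alg_kernel :: "('k, 'a) nu_algebra \<Rightarrow> ('k, 'b) nu_algebra \<Rightarrow> ('a \<Rightarrow> 'b) \<Rightarrow> 'a set" where
  "alg_kernel A B f = {a \<in> alg_carrier A. f a = alg_zero B}"

lemma algebra_hom_comp:
  assumes "algebra_hom A B f" "algebra_hom B C g"
  shows "algebra_hom A C (\<lambda>a. g (f a))"
  using assms unfolding algebra_hom_def by (auto simp: image_subset_iff)

lemma ideal_generated_minimal:
  "\<lbrakk>alg_ideal A I; S \<subseteq> I\<rbrakk> \<Longrightarrow> ideal_generated A S \<subseteq> I"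
  unfolding ideal_generated_def by (rule hull_minimal)

lemma ideal_generated_superset: "S \<subseteq> ideal_generated A S"
  unfolding ideal_generated_def by (rule hull_subset)

context nu_algebra
begin

lemma zero_smult: "a \<in> alg_carrier A \<Longrightarrow> alg_smult A 0 a = alg_zero A"
  using add_smult[of a "- 1" 1] by (simp add: add_inverse one_smult)

lemma smult_zero: "alg_smult A x (alg_zero A) = alg_zero A"
  using smult_smult[OF zero_closed, of x 0] by (simp add: zero_smult zero_closed)

lemma mult_zero_left: "a \<in> alg_carrier A \<Longrightarrow> alg_mult A (alg_zero A) a = alg_zero A"
  by (metis zero_smult zero_closed mult_closed smult_mult_left)

lemma mult_zero_right: "a \<in> alg_carrier A \<Longrightarrow> alg_mult A a (alg_zero A) = alg_zero A"
  by (metis zero_smult zero_closed mult_closed smult_mult_right)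

text \<open>The record has no subtraction, so the difference is written with the scalar
  \<open>- 1\<close>. This turns equality of images under a homomorphism into membership in its
  kernel.\<close>

lemma eq_iff_diff_zero:
  assumes "a \<in> alg_carrier A" "b \<in> alg_carrier A"
  shows "a = b \<longleftrightarrow> alg_add A (alg_smult A (- 1) b) a = alg_zero A"
proof
  assume "alg_add A (alg_smult A (- 1) b) a = alg_zero A"
  then have "alg_add A b (alg_add A (alg_smult A (- 1) b) a) = b"
    using assms by (simp add: add_comm[of b] zero_closed add_zero)
  then show "a = b"
    using assms
    by (simp add: add_assoc[symmetric] smult_closed add_comm[of b "alg_smult A (- 1) b"]
        add_inverse add_zero)
qed (use assms add_inverse in simp)

end

text \<open>Zero is the scalar \<open>0\<close> times any element, so compatibility with scalars
  already forces it to be preserved.\<close>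

lemma algebra_hom_zero:
  assumes "nu_algebra A" "nu_algebra B" "algebra_hom A B f"
  shows "f (alg_zero A) = alg_zero B"
proof -
  interpret A: nu_algebra A by fact
  interpret B: nu_algebra B by fact
  have "f (alg_smult A 0 (alg_zero A)) = alg_smult B 0 (f (alg_zero A))" "f (alg_zero A) \<in> alg_carrier B"
    using assms(3) A.zero_closed by (auto simp: algebra_hom_def)
  then show ?thesis by (simp add: A.smult_zero B.zero_smult)
qed

lemma alg_ideal_kernel:
  assumes "nu_algebra A" "nu_algebra B" "algebra_hom A B f"
  shows "alg_ideal A (alg_kernel A B f)"
proof -
  interpret A: nu_algebra A by fact
  interpret B: nu_algebra B by fact
  have "f a \<in> alg_carrier B" if "a \<in> alg_carrier A" for a
    using assms(3) that by (auto simp: algebra_hom_def)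
  moreover note algebra_hom_zero[OF assms]
  ultimately show ?thesis
    using assms(3) unfolding alg_ideal_def alg_kernel_def algebra_hom_def
    by (auto simp: A.zero_closed A.add_closed A.mult_closed A.smult_closed B.zero_closed B.add_zero
        B.smult_zero B.mult_zero_left B.mult_zero_right)
qed

text \<open>Surjectivity lets every multiplier in \<open>B\<close> be lifted to \<open>A\<close>,
  where the ideal \<open>I\<close> absorbs it.\<close>

lemma alg_ideal_surjective_image:
  assumes hom: "algebra_hom A B f" and surj: "f ` alg_carrier A = alg_carrier B"
    and "nu_algebra A" "nu_algebra B" and ideal: "alg_ideal A I"
  shows "alg_ideal B (f ` I)"
proof -
  interpret A: nu_algebra_ideal A I
    by (intro nu_algebra_ideal.intro nu_algebra_ideal_axioms.intro) fact+
  have add: "alg_add B (f a) (f b) = f (alg_add A a b)"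
    and mult: "alg_mult B (f a) (f b) = f (alg_mult A a b)"
    if "a \<in> alg_carrier A" "b \<in> alg_carrier A" for a b
    using hom that by (simp_all add: algebra_hom_def)
  have smult: "alg_smult B x (f a) = f (alg_smult A x a)" if "a \<in> alg_carrier A" for a x
    using hom that by (simp add: algebra_hom_def)
  have zero: "alg_zero B = f (alg_zero A)"
    using algebra_hom_zero[OF assms(3,4) hom] by simp
  show ?thesis
    unfolding alg_ideal_def surj[symmetric]
    by (auto simp: zero add mult smult A.ideal_carrier
        intro: A.ideal_zero A.ideal_add A.ideal_smult A.ideal_mult_left A.ideal_mult_right)
qed

text \<open>Both \<open>B\<close> and \<open>C\<close> are \<open>A\<close> modulo the same ideal.
  Applied to differences, equality of the kernels says that \<open>f\<close> and \<open>g\<close>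
  identify the same pairs, so sending \<open>f a\<close> to \<open>g a\<close> is well defined and
  injective.\<close>

lemma isomorphic_if_kernels_eq:
  assumes "nu_algebra A" "nu_algebra B" "nu_algebra C"
    and f: "algebra_hom A B f" "f ` alg_carrier A = alg_carrier B"
    and g: "algebra_hom A C g" "g ` alg_carrier A = alg_carrier C"
    and ker: "alg_kernel A B f = alg_kernel A C g"
  shows "\<exists>\<phi>. algebra_iso B C \<phi>"
proof -
  interpret A: nu_algebra A by fact
  interpret B: nu_algebra B by fact
  interpret C: nu_algebra C by fact
  have fg: "f a = f b \<longleftrightarrow> g a = g b" if ab: "a \<in> alg_carrier A" "b \<in> alg_carrier A" for a b
  proof -
    define d where "d = alg_add A (alg_smult A (- 1) b) a"
    have d: "d \<in> alg_carrier A"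
      unfolding d_def using ab by (intro A.add_closed A.smult_closed)
    have im: "f a \<in> alg_carrier B" "f b \<in> alg_carrier B" "g a \<in> alg_carrier C" "g b \<in> alg_carrier C"
      using ab f(2) g(2) by auto
    have "f a = f b \<longleftrightarrow> f d = alg_zero B"
      using f(1) ab im by (simp add: B.eq_iff_diff_zero d_def algebra_hom_def A.smult_closed)
    also have "\<dots> \<longleftrightarrow> g d = alg_zero C"
      using ker d by (auto simp: alg_kernel_def)
    also have "\<dots> \<longleftrightarrow> g a = g b"
      using g(1) ab im by (simp add: C.eq_iff_diff_zero d_def algebra_hom_def A.smult_closed)
    finally show ?thesis .
  qed
  \<comment> \<open>The choice of preimage is immaterial: by \<open>fg\<close>, \<open>g\<close> is
    constant on the fibres of \<open>f\<close>.\<close>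
  define \<phi> where "\<phi> = (\<lambda>b. g (inv_into (alg_carrier A) f b))"
  have \<phi>: "\<phi> (f a) = g a" if "a \<in> alg_carrier A" for a
    using that fg f_inv_into_f[of "f a" f "alg_carrier A"] inv_into_into[of "f a" f "alg_carrier A"]
    unfolding \<phi>_def by blast
  have "bij_betw \<phi> (alg_carrier B) (alg_carrier C)"
    unfolding bij_betw_def inj_on_def f(2)[symmetric] g(2)[symmetric]
    by (auto simp: \<phi> fg image_iff)
  moreover have "\<phi> (alg_add B (f a) (f b)) = alg_add C (\<phi> (f a)) (\<phi> (f b))"
    "\<phi> (alg_mult B (f a) (f b)) = alg_mult C (\<phi> (f a)) (\<phi> (f b))"
    "\<phi> (alg_smult B x (f a)) = alg_smult C x (\<phi> (f a))"
    if ab: "a \<in> alg_carrier A" "b \<in> alg_carrier A" for a b x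
  proof -
    have "alg_add B (f a) (f b) = f (alg_add A a b)" "alg_mult B (f a) (f b) = f (alg_mult A a b)"
      "alg_smult B x (f a) = f (alg_smult A x a)"
      "alg_add C (g a) (g b) = g (alg_add A a b)" "alg_mult C (g a) (g b) = g (alg_mult A a b)"
      "alg_smult C x (g a) = g (alg_smult A x a)"
      using f(1) g(1) ab by (simp_all add: algebra_hom_def)
    then show "\<phi> (alg_add B (f a) (f b)) = alg_add C (\<phi> (f a)) (\<phi> (f b))"
      "\<phi> (alg_mult B (f a) (f b)) = alg_mult C (\<phi> (f a)) (\<phi> (f b))"
      "\<phi> (alg_smult B x (f a)) = alg_smult C x (\<phi> (f a))"
      using ab by (simp_all add: \<phi> A.add_closed A.mult_closed A.smult_closed)
  qed
  ultimately show ?thesis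
    unfolding algebra_iso_def f(2)[symmetric] by blast
qed

section \<open>The projection onto a quotient algebra and its kernel\<close>

context nu_algebra_ideal
begin

lemma algebra_hom_coset: "algebra_hom A (quotient_algebra A I) (coset A I)"
  unfolding algebra_hom_def
  by (auto simp: quotient_add quotient_mult quotient_smult) (simp add: quotient_algebra_def)

lemma coset_image_carrier: "coset A I ` alg_carrier A = alg_carrier (quotient_algebra A I)"
  by (simp add: quotient_algebra_def)

lemma coset_eq_zero_iff:
  assumes "a \<in> alg_carrier A"
  shows "coset A I a = alg_zero (quotient_algebra A I) \<longleftrightarrow> a \<in> I"
proof -
  \<comment> \<open>As a set, the zero of the quotient is the coset of zero, which is
    \<open>I\<close> itself.\<close>
  have zero: "alg_zero (quotient_algebra A I) = I"
    using add_zero ideal_carrier by (auto simp: quotient_algebra_def coset_def image_iff)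
  show ?thesis
  proof
    show "a \<in> I" if "coset A I a = alg_zero (quotient_algebra A I)"
      using coset_self[OF assms] that zero by simp
    show "coset A I a = alg_zero (quotient_algebra A I)" if "a \<in> I"
      using coset_shift[OF zero_closed that] assms that by (simp add: quotient_algebra_def add_zero)
  qed
qed

end

section \<open>Restricting noncommutative polynomials to an alphabet\<close>

text \<open>A polynomial is a finite sum of monomials. The alternative \<open>c = 0\<close> supplies
  the zero polynomial as a monomial, with an arbitrary key, even when \<open>S\<close> is
  empty.\<close>

lemma poly_mapping_induct [consumes 1, case_names single add]:
  fixes p :: "'a \<Rightarrow>\<^sub>0 'b::monoid_add"
  assumes "Poly_Mapping.keys p \<subseteq> S"
    and "\<And>u c. c = 0 \<or> u \<in> S \<Longrightarrow> P (Poly_Mapping.single u c)"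
    and "\<And>p q. \<lbrakk>P p; P q\<rbrakk> \<Longrightarrow> P (p + q)"
  shows "P p"
  using assms(1)
proof (induction p rule: update_induct)
  case const
  then show ?case using assms(2)[of 0 undefined] by simp
next
  case (update p u c)
  have "Poly_Mapping.update u c p = Poly_Mapping.single u c + p"
    using update(1)
    by (intro poly_mapping_eqI) (auto simp: lookup_update lookup_add lookup_single in_keys_iff when_def)
  moreover have "u \<in> S" "Poly_Mapping.keys p \<subseteq> S"
    using update by (auto simp: keys_update split: if_splits)
  ultimately show ?case using update(3) assms(2,3) by auto
qed

text \<open>This is the substitution that fixes the letters in \<open>Y\<close> and sends all others
  to zero, given directly as deletion of the monomials with a letter outside
  \<open>Y\<close>.\<close>

definition restrict_letters :: "'g set \<Rightarrow> ('g, 'k::field) nc_poly \<Rightarrow> ('g, 'k) nc_poly" where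
  "restrict_letters Y p =
     (\<Sum>u\<in>Poly_Mapping.keys p. if set (letters u) \<subseteq> Y then Poly_Mapping.single u (Poly_Mapping.lookup p u) else 0)"

lemma restrict_letters_add:
  "restrict_letters Y (p + q) = restrict_letters Y p + restrict_letters Y q"
  unfolding restrict_letters_def
  by (rule setsum_keys_plus_distrib) (auto simp: single_add)

lemma restrict_letters_single:
  "restrict_letters Y (Poly_Mapping.single u c)
     = (if set (letters u) \<subseteq> Y then Poly_Mapping.single u c else 0)"
  by (simp add: restrict_letters_def)

lemma restrict_letters_zero: "restrict_letters Y 0 = 0"
  by (simp add: restrict_letters_def)

lemma restrict_letters_diff:
  "restrict_letters Y (p - q) = restrict_letters Y p - restrict_letters Y q"
  using restrict_letters_add[of Y "p - q" q] by simp

lemma restrict_letters_sum: "restrict_letters Y (sum f S) = (\<Sum>x\<in>S. restrict_letters Y (f x))"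
  by (induction S rule: infinite_finite_induct) (simp_all add: restrict_letters_zero restrict_letters_add)

text \<open>By bilinearity it suffices to treat monomials, and a concatenation is a word over
  \<open>Y\<close> exactly when both factors are.\<close>

lemma restrict_letters_mult:
  "restrict_letters Y (p * q) = restrict_letters Y p * restrict_letters Y q"
proof (induction p rule: poly_mapping_induct[OF subset_UNIV])
  case (1 u c)
  show ?case
  proof (induction q rule: poly_mapping_induct[OF subset_UNIV])
    case (1 v d)
    then show ?case by (simp add: mult_single restrict_letters_single plus_word_def)
  next
    case (2 p q)
    then show ?case by (simp add: distrib_left restrict_letters_add)
  qed
next
  case (2 p q)
  then show ?case by (simp add: distrib_right restrict_letters_add)
qed

lemma restrict_letters_id:
  assumes "\<And>u. u \<in> Poly_Mapping.keys p \<Longrightarrow> set (letters u) \<subseteq> Y"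
  shows "restrict_letters Y p = p"
proof -
  have "Poly_Mapping.keys p \<subseteq> {u. set (letters u) \<subseteq> Y}"
    using assms by auto
  then show ?thesis
    by (induction p rule: poly_mapping_induct)
      (auto simp: restrict_letters_single restrict_letters_add)
qed

lemma keys_restrict_letters:
  "Poly_Mapping.keys (restrict_letters Y p) \<subseteq> {u \<in> Poly_Mapping.keys p. set (letters u) \<subseteq> Y}"
proof -
  have "Poly_Mapping.keys (restrict_letters Y p)
      \<subseteq> (\<Union>u\<in>Poly_Mapping.keys p. Poly_Mapping.keys (if set (letters u) \<subseteq> Y
          then Poly_Mapping.single u (Poly_Mapping.lookup p u) else 0))"
    unfolding restrict_letters_def by (rule Poly_Mapping.keys_sum)
  also have "\<dots> \<subseteq> {u \<in> Poly_Mapping.keys p. set (letters u) \<subseteq> Y}"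
    by (auto split: if_splits)
  finally show ?thesis .
qed

text \<open>Scaling becomes multiplication by a constant of the ambient ring of polynomials, so that
  ring laws and multiplicativity of maps cover scalars too.\<close>

lemma free_algebra_ops:
  "alg_zero (free_algebra X) = 0"
  "alg_add (free_algebra X) = (+)"
  "alg_mult (free_algebra X) = (*)"
  "alg_smult (free_algebra X) = (\<lambda>x p. Poly_Mapping.single 0 x * p)"
  by (simp_all add: free_algebra_def map_times_conv_mult fun_eq_iff)

lemma restrict_letters_hom:
  "algebra_hom (free_algebra X) (free_algebra Y) (restrict_letters Y)"
  unfolding algebra_hom_def free_algebra_ops
proof (intro conjI ballI allI)
  show "restrict_letters Y ` alg_carrier (free_algebra X) \<subseteq> alg_carrier (free_algebra Y)"
    using keys_restrict_letters by (fastforce simp: free_algebra_def)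
qed (simp_all add: restrict_letters_add restrict_letters_mult restrict_letters_single zero_word_def)

lemma restrict_letters_carrier:
  "p \<in> alg_carrier (free_algebra Y) \<Longrightarrow> restrict_letters Y p = p"
  by (rule restrict_letters_id) (auto simp: free_algebra_def)

lemma free_algebra_mono:
  "Y \<subseteq> X \<Longrightarrow> alg_carrier (free_algebra Y) \<subseteq> alg_carrier (free_algebra X)"
  by (auto simp: free_algebra_def)

lemma restrict_letters_image:
  assumes "Y \<subseteq> X"
  shows "restrict_letters Y ` alg_carrier (free_algebra X) = alg_carrier (free_algebra Y)"
proof
  show "restrict_letters Y ` alg_carrier (free_algebra X) \<subseteq> alg_carrier (free_algebra Y)"
    using restrict_letters_hom[unfolded algebra_hom_def] by blast
  show "alg_carrier (free_algebra Y) \<subseteq> restrict_letters Y ` alg_carrier (free_algebra X)"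
    by (intro subsetI, rule image_eqI, rule restrict_letters_carrier[symmetric], assumption)
      (rule subsetD[OF free_algebra_mono[OF assms]])
qed

lemma restrict_letters_gen: "restrict_letters Y (gen x) = (if x \<in> Y then gen x else 0)"
  by (simp add: gen_def restrict_letters_single)

text \<open>A word with a letter outside \<open>Y\<close> factors through that letter, hence lies in any ideal
  containing it.\<close>

lemma diff_restrict_letters_in_ideal:
  assumes ideal: "alg_ideal (free_algebra X) K"
    and letters: "\<And>x. x \<in> X - Y \<Longrightarrow> gen x \<in> K"
    and p: "p \<in> alg_carrier (free_algebra X)"
  shows "p - restrict_letters Y p \<in> (K :: ('g, 'k::field) nc_poly set)"
proof -
  interpret F: nu_algebra_ideal "free_algebra X" K
    by (intro nu_algebra_ideal.intro nu_algebra_ideal_axioms.intro free_algebra_nu_algebra ideal)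
  note zero = F.ideal_zero[unfolded free_algebra_ops]
    and smult = F.ideal_smult[unfolded free_algebra_ops]
    and left = F.ideal_mult_left[unfolded free_algebra_ops]
    and right = F.ideal_mult_right[unfolded free_algebra_ops]
  have word_carrier: "Poly_Mapping.single (Word us) 1 \<in> alg_carrier (free_algebra X)"
    if "us \<noteq> []" "set us \<subseteq> X" for us
    using that by (auto simp: free_algebra_def)
  have mult_word: "Poly_Mapping.single (Word (us @ vs)) 1
      = Poly_Mapping.single (Word us) (1::'k) * Poly_Mapping.single (Word vs) 1" for us vs :: "'g list"
    by (simp add: mult_single plus_word_def)
  have word: "Poly_Mapping.single (Word us) 1 \<in> K" if us: "set us \<subseteq> X" "\<not> set us \<subseteq> Y" for us
  proof -
    obtain x where x: "x \<in> set us" "x \<in> X - Y" using us by blast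
    then obtain as bs where split: "us = as @ x # bs" by (meson split_list)
    \<comment> \<open>The algebra has no unit, so an empty cofactor is not an element of the
      carrier; the absence of letters after or before \<open>x\<close> needs separate cases.\<close>
    have tail: "Poly_Mapping.single (Word (x # bs)) 1 \<in> K"
    proof (cases "bs = []")
      case True
      then show ?thesis using letters[OF x(2)] by (simp add: gen_def)
    next
      case False
      then show ?thesis
        using right[OF letters[OF x(2)] word_carrier[OF False]] us(1) split
          mult_word[of "[x]" bs] by (simp add: gen_def)
    qed
    show ?thesis
    proof (cases "as = []")
      case True
      then show ?thesis using tail split by simp
    next
      case False
      then show ?thesis
        using left[OF word_carrier[OF False] tail] us(1) split mult_word[of as "x # bs"] by simp
    qed
  qed
  have "Poly_Mapping.keys p \<subseteq> {u. set (letters u) \<subseteq> X}"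
    using p by (auto simp: free_algebra_def)
  then show ?thesis
  proof (induction p rule: poly_mapping_induct)
    case (single u c)
    show ?case
    proof (cases "c = 0 \<or> set (letters u) \<subseteq> Y")
      case True
      then show ?thesis by (auto simp: restrict_letters_single restrict_letters_zero zero)
    next
      case False
      then have "Poly_Mapping.single (Word (letters u)) 1 \<in> K"
        using single by (intro word) auto
      then have "Poly_Mapping.single 0 c * Poly_Mapping.single (Word (letters u)) 1 \<in> K"
        by (rule smult)
      then show ?thesis using False by (simp add: mult_single restrict_letters_single)
    qed
  next
    case (add p q)
    then show ?case
      using F.ideal_add[unfolded free_algebra_ops]
      by (metis (no_types, lifting) add_diff_add restrict_letters_add)
  qed
qed

section \<open>Vertices are nonzero in weighted Leavitt path algebras\<close>

text \<open>A partial map on \<open>'x\<close> for each letter makes noncommutative polynomials act on functions on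
  \<open>'x\<close> by composition with the maps, functions being extended by zero.\<close>

primrec word_act :: "('g \<Rightarrow> 'x \<Rightarrow> 'x option) \<Rightarrow> 'g list \<Rightarrow> ('x \<Rightarrow> 'k::field) \<Rightarrow> 'x \<Rightarrow> 'k" where
  "word_act t [] f = f"
| "word_act t (g # us) f = (\<lambda>x. case t g x of None \<Rightarrow> 0 | Some y \<Rightarrow> word_act t us f y)"

definition poly_act ::
    "('g \<Rightarrow> 'x \<Rightarrow> 'x option) \<Rightarrow> ('g, 'k::field) nc_poly \<Rightarrow> ('x \<Rightarrow> 'k) \<Rightarrow> 'x \<Rightarrow> 'k" where
  "poly_act t p f x =
     (\<Sum>u\<in>Poly_Mapping.keys p. Poly_Mapping.lookup p u * word_act t (letters u) f x)"

lemma word_act_append: "word_act t (us @ vs) f = word_act t us (word_act t vs f)"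
  by (induction us) (simp_all add: fun_eq_iff split: option.split)

lemma word_act_add: "word_act t us (\<lambda>x. f x + g x) = (\<lambda>x. word_act t us f x + word_act t us g x)"
  by (induction us) (simp_all add: fun_eq_iff split: option.split)

lemma word_act_smult: "word_act t us (\<lambda>x. c * f x) = (\<lambda>x. c * word_act t us f x)"
  by (induction us) (simp_all add: fun_eq_iff split: option.split)

lemma poly_act_single:
  "poly_act t (Poly_Mapping.single u c) f = (\<lambda>x. c * word_act t (letters u) f x)"
  by (simp add: poly_act_def fun_eq_iff)

lemma poly_act_zero: "poly_act t 0 f = (\<lambda>x. 0)"
  by (simp add: poly_act_def fun_eq_iff)

lemma poly_act_add: "poly_act t (p + q) f = (\<lambda>x. poly_act t p f x + poly_act t q f x)"
  unfolding poly_act_def fun_eq_iff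
  by (intro allI setsum_keys_plus_distrib) (auto simp: distrib_right)

lemma poly_act_diff: "poly_act t (p - q) f = (\<lambda>x. poly_act t p f x - poly_act t q f x)"
  using poly_act_add[of t "p - q" q f] by (simp add: fun_eq_iff)

lemma poly_act_sum: "poly_act t (sum h S) f = (\<lambda>x. \<Sum>i\<in>S. poly_act t (h i) f x)"
  by (induction S rule: infinite_finite_induct) (simp_all add: poly_act_zero poly_act_add)

lemma poly_act_fun_add:
  "poly_act t p (\<lambda>x. f x + g x) = (\<lambda>x. poly_act t p f x + poly_act t p g x)"
  by (simp add: poly_act_def fun_eq_iff word_act_add distrib_left sum.distrib)

text \<open>Bilinearity reduces this to words, where concatenation is composition of the operators.
  This makes the functions on \<open>'x\<close> a module.\<close>

lemma poly_act_mult: "poly_act t (p * q) f = poly_act t p (poly_act t q f)"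
proof (induction p rule: poly_mapping_induct[OF subset_UNIV])
  case (1 u c)
  show ?case
  proof (induction q rule: poly_mapping_induct[OF subset_UNIV])
    case (1 v d)
    then show ?case
      by (simp add: mult_single poly_act_single plus_word_def word_act_append word_act_smult mult.assoc)
  next
    case (2 p q)
    then show ?case by (simp add: distrib_left poly_act_add poly_act_fun_add)
  qed
next
  case (2 p q)
  then show ?case by (simp add: distrib_right poly_act_add)
qed

lemma poly_act_fun_zero: "poly_act t p (\<lambda>x. 0) = (\<lambda>x. 0)"
  \<comment> \<open>The zero function is obtained as the action of the zero polynomial on an
    arbitrary function.\<close>
  using poly_act_mult[of t p 0 undefined] by (simp add: poly_act_zero)

lemma poly_act_gen: "poly_act t (gen g) f = (\<lambda>x. case t g x of None \<Rightarrow> 0 | Some y \<Rightarrow> f y)"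
  by (simp add: gen_def poly_act_single fun_eq_iff split: option.split)

text \<open>Since the annihilator is an ideal, a whole relation ideal acts by zero as soon as its
  relators do.\<close>

lemma alg_ideal_annihilator:
  "alg_ideal (free_algebra X) {p \<in> alg_carrier (free_algebra X). \<forall>f. poly_act t p f = (\<lambda>x. 0)}"
proof -
  interpret F: nu_algebra "free_algebra X"
    by (rule free_algebra_nu_algebra)
  note closed = F.zero_closed F.add_closed F.mult_closed F.smult_closed
  show ?thesis
    unfolding alg_ideal_def using closed[unfolded free_algebra_ops]
    by (auto simp: free_algebra_ops poly_act_zero poly_act_add poly_act_mult poly_act_fun_zero
        poly_act_single)
qed

text \<open>One edge of maximal weight absorbs all rows but the first and what the other edges leave of the
  first row.\<close>

lemma exists_weighted_bijection:
  fixes w :: "'e \<Rightarrow> nat"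
  assumes "finite S" "S \<noteq> {}" and pos: "\<And>e. e \<in> S \<Longrightarrow> 0 < w e"
  shows "\<exists>\<sigma>. bij_betw \<sigma> (S \<times> (UNIV :: nat set)) ((UNIV :: nat set) \<times> {1..Max (w ` S)}) \<and>
    (\<forall>e\<in>S. \<forall>n. snd (\<sigma> (e, n)) \<le> w e)"
proof -
  have "Max (w ` S) \<in> w ` S"
    using assms by (intro Max_in) auto
  then obtain d where d: "d \<in> S" "w d = Max (w ` S)" by auto
  define T where "T = (S - {d}) \<times> (UNIV :: nat set)"
  \<comment> \<open>The edges other than \<open>d\<close> occupy only even positions of row 1, a row
    allowed by every positive weight. The odd positions stay free, so the remainder \<open>R\<close>
    is infinite even if there is just one row. It can be handed to \<open>d\<close>, whose weight
    admits all rows.\<close>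
  define f where "f = (\<lambda>x. (2 * to_nat_on T x, 1 :: nat))"
  define R where "R = (UNIV :: nat set) \<times> {1..Max (w ` S)} - f ` T"
  have "countable T"
    unfolding T_def using assms(1) by (intro countable_SIGMA) (auto intro: countable_finite)
  then have f: "bij_betw f T (f ` T)"
    using inj_on_to_nat_on[of T] by (auto simp: f_def inj_on_def bij_betw_def)
  have "infinite R"
  proof (rule infinite_super)
    have "1 \<le> Max (w ` S)"
      using pos[OF d(1)] d(2) by simp
    then show "range (\<lambda>n. (2 * n + 1, 1)) \<subseteq> R"
      by (auto simp: R_def f_def) presburger
    show "infinite (range (\<lambda>n :: nat. (2 * n + 1, 1 :: nat)))"
      by (intro range_inj_infinite injI) simp
  qed
  moreover have "countable R"
    by simp
  ultimately have "bij_betw (from_nat_into R) UNIV R"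
    by (rule bij_betw_from_nat_into[rotated])
  moreover have "bij_betw snd ({d} \<times> (UNIV :: nat set)) UNIV"
    by (auto simp: bij_betw_def inj_on_def image_iff)
  ultimately have g: "bij_betw (from_nat_into R \<circ> snd) ({d} \<times> (UNIV :: nat set)) R"
    by (rule bij_betw_trans[rotated])
  define \<sigma> where "\<sigma> = (\<lambda>x. if x \<in> T then f x else (from_nat_into R \<circ> snd) x)"
  have "bij_betw \<sigma> (T \<union> {d} \<times> (UNIV :: nat set)) (f ` T \<union> R)"
    unfolding \<sigma>_def
    by (rule bij_betw_disjoint_Un[OF f g]) (auto simp: T_def R_def)
  moreover have "T \<union> {d} \<times> UNIV = S \<times> UNIV"
    using d(1) by (auto simp: T_def)
  moreover have "f ` T \<union> R = UNIV \<times> {1..Max (w ` S)}"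
    using pos[OF d(1)] d(2) by (auto simp: R_def f_def)
  ultimately have \<sigma>: "bij_betw \<sigma> (S \<times> UNIV) (UNIV \<times> {1..Max (w ` S)})" by simp
  have "snd (\<sigma> (e, n)) \<le> w e" if "e \<in> S" for e n
  proof (cases "e = d")
    case True
    then show ?thesis
      using bij_betwE[OF \<sigma>] that d(2) by (auto simp: mem_Times_iff)
  next
    case False
    then show ?thesis
      using that pos[OF that] by (simp add: \<sigma>_def T_def f_def)
  qed
  with \<sigma> show ?thesis by blast
qed

text \<open>On functions on \<open>'v \<times> nat\<close>, a vertex \<open>v\<close> acts as the projection to the fibre over \<open>v\<close>. The
  bijections \<open>\<sigma> v\<close> identify \<open>w v\<close> copies of the fibre over \<open>v\<close> with the sum of the fibres over the
  ranges of the edges emitted by \<open>v\<close>, and the \<open>e\<^sub>i\<close> and \<open>e\<^sub>i\<^sup>*\<close> act as the entries of this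
  isomorphism and of its inverse.\<close>

primrec letter_map :: "('v, 'e) pre_digraph \<Rightarrow> ('v \<Rightarrow> 'e \<times> nat \<Rightarrow> nat \<times> nat) \<Rightarrow>
    ('v, 'e) letter \<Rightarrow> 'v \<times> nat \<Rightarrow> ('v \<times> nat) option" where
  "letter_map E \<sigma> (Vertex v) x = (if fst x = v then Some x else None)"
| "letter_map E \<sigma> (Real_Edge e i) x =
     (if fst x = tail E e \<and> (\<exists>n. \<sigma> (tail E e) (e, n) = (snd x, i))
      then Some (head E e, THE n. \<sigma> (tail E e) (e, n) = (snd x, i)) else None)"
| "letter_map E \<sigma> (Ghost_Edge e i) x =
     (if fst x = head E e \<and> snd (\<sigma> (tail E e) (e, snd x)) = i
      then Some (tail E e, fst (\<sigma> (tail E e) (e, snd x))) else None)"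

context row_finite_weighted_graph
begin

lemma regular_tail: "e \<in> arcs E \<Longrightarrow> tail E e \<in> regular_verts E"
  using row_finite[of "tail E e"] by (auto simp: regular_verts_def out_arcs_def)

text \<open>All relators act by zero in the representation given by \<open>letter_map\<close>, hence
  so does the relation ideal, whereas \<open>v\<close> acts as a nonzero projection.\<close>

lemma vertex_gen_notin_relation_ideal:
  assumes "v \<in> verts E"
  shows "vertex_gen v \<notin> (wlpa_relation_ideal E w :: (('v, 'e) letter, 'k::field) nc_poly set)"
proof -
  define P where "P = (\<lambda>v \<sigma>. bij_betw \<sigma> (out_arcs E v \<times> (UNIV :: nat set))
      ((UNIV :: nat set) \<times> {1..vertex_weight E w v}) \<and>
    (\<forall>e\<in>out_arcs E v. \<forall>n. snd (\<sigma> (e, n)) \<le> w e))"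
  have "\<exists>\<sigma>. P v \<sigma>" if "v \<in> regular_verts E" for v
    unfolding P_def vertex_weight_def using that weight_pos
    by (intro exists_weighted_bijection) (auto simp: regular_verts_def)
  then obtain \<sigma> where \<sigma>: "\<And>v. v \<in> regular_verts E \<Longrightarrow> P v (\<sigma> v)"
    by metis
  have bij: "bij_betw (\<sigma> v) (out_arcs E v \<times> UNIV) (UNIV \<times> {1..vertex_weight E w v})"
    if "v \<in> regular_verts E" for v
    using \<sigma>[OF that] by (simp add: P_def)
  have inj: "e = f \<and> m = n"
    if "\<sigma> (tail E e) (e, m) = \<sigma> (tail E e) (f, n)" "e \<in> arcs E" "f \<in> arcs E" "tail E f = tail E e"
    for e f m n
  proof -
    have "(e, m) = (f, n)"
      by (rule inj_onD[OF bij_betw_imp_inj_on[OF bij[OF regular_tail[OF that(2)]]] that(1)])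
        (simp_all add: that(2-4))
    then show ?thesis by simp
  qed
  \<comment> \<open>An edge never reaches a row above its own weight. This matches the convention
    that \<open>real_gen w e i\<close> and \<open>ghost_gen w e i\<close> vanish for
    \<open>i > w e\<close>.\<close>
  have range: "snd (\<sigma> (tail E e) (e, n)) \<in> {1..w e}" if "e \<in> arcs E" for e n
    using bij_betwE[OF bij[OF regular_tail[OF that]]] \<sigma>[OF regular_tail[OF that]] that
    by (force simp: P_def mem_Times_iff)
  define act :: "(('v, 'e) letter, 'k) nc_poly \<Rightarrow> ('v \<times> nat \<Rightarrow> 'k) \<Rightarrow> 'v \<times> nat \<Rightarrow> 'k"
    where "act = poly_act (letter_map E \<sigma>)"
  have act_vertex: "act (vertex_gen u) f = (\<lambda>x. if fst x = u then f x else 0)" for u f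
    by (auto simp: act_def vertex_gen_def poly_act_gen fun_eq_iff)
  \<comment> \<open>Injectivity of \<open>\<sigma>\<close> makes the definite description in
    \<open>letter_map\<close> proper.\<close>
  have the_n: "(THE n'. \<sigma> (tail E e) (e, n') = \<sigma> (tail E e) (e, n)) = n" if "e \<in> arcs E" for e n
    using inj[OF _ that that] by (intro the_equality) auto
  \<comment> \<open>The formula is valid for every \<open>i\<close>: outside \<open>{1..w e}\<close>
    the generator is zero, and by \<open>range\<close> the condition on the right fails.\<close>
  have act_real: "act (real_gen w e i) f x =
      (if fst x = tail E e \<and> (\<exists>n. \<sigma> (tail E e) (e, n) = (snd x, i))
       then f (head E e, THE n. \<sigma> (tail E e) (e, n) = (snd x, i)) else 0)"
    if "e \<in> arcs E" for e i f x
  proof (cases "i \<in> {1..w e}")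
    case True
    then show ?thesis by (auto simp: act_def real_gen_def poly_act_gen)
  next
    case False
    then have "\<sigma> (tail E e) (e, n) \<noteq> (snd x, i)" for n
      using range[OF that, of n] by auto
    moreover have "real_gen w e i = (0 :: (('v, 'e) letter, 'k) nc_poly)"
      using False by (simp only: real_gen_def if_False)
    ultimately show ?thesis by (simp add: act_def poly_act_zero)
  qed
  have act_real_eq: "act (real_gen w e i) f (tail E e, m) = f (head E e, n)"
    if "e \<in> arcs E" "\<sigma> (tail E e) (e, n) = (m, i)" for e i f m n
    using that the_n[OF that(1), of n] by (auto simp: act_real)
  have act_ghost: "act (ghost_gen w e i) f x =
      (if fst x = head E e \<and> snd (\<sigma> (tail E e) (e, snd x)) = i
       then f (tail E e, fst (\<sigma> (tail E e) (e, snd x))) else 0)"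
    if "e \<in> arcs E" for e i f x
    using range[OF that, of "snd x"] by (auto simp: act_def ghost_gen_def poly_act_gen poly_act_zero)
  have act_mult: "act (p * q) f = act p (act q f)"
    and act_diff: "act (p - q) f x = act p f x - act q f x"
    and act_sum: "act (sum h S) f x = (\<Sum>i\<in>S. act (h i) f x)"
    and act_zero: "act 0 f x = 0"
    for p q f x h and S :: "'s set"
    by (simp_all add: act_def poly_act_mult poly_act_diff poly_act_sum poly_act_zero)
  let ?X = "wlpa_letters E w"
  define J where "J = {p \<in> alg_carrier (free_algebra ?X). \<forall>f. act p f = (\<lambda>x. 0)}"
  have "act p f x = 0" if "p \<in> wlpa_relators E w" for p f x
    using that
  proof cases
    case (vertices u v)
    then show ?thesis by (simp add: act_diff act_mult act_vertex act_zero)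
  next
    case (real_source e i)
    then show ?thesis by (simp add: act_diff act_mult act_vertex act_real)
  next
    case (real_range e i)
    then show ?thesis by (auto simp: act_diff act_mult act_vertex act_real)
  next
    case (ghost_source e i)
    then show ?thesis by (simp add: act_diff act_mult act_vertex act_ghost)
  next
    case (ghost_range e i)
    then show ?thesis by (simp add: act_diff act_mult act_vertex act_ghost)
  next
    case (real_ghost v i j)
    show ?thesis
    proof (cases "fst x = v")
      case False
      then have "act (real_gen w e i * ghost_gen w e j) f x = 0" if "e \<in> out_arcs E v" for e
        using that by (auto simp: act_mult act_real)
      with False show ?thesis by (simp add: real_ghost(1) act_diff act_sum act_vertex act_zero)
    next
      case True
      obtain m where x: "x = (v, m)" using True by (cases x) auto
      \<comment> \<open>By surjectivity \<open>(m, i)\<close> comes from some \<open>(e, n)\<close>,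
        and by injectivity from no other edge. Hence only the summand of \<open>e\<close> survives
        at the point \<open>(v, m)\<close>; its ghost edge leads back to \<open>(v, m)\<close> if
        \<open>i = j\<close> and gives zero otherwise.\<close>
      have "(m, i) \<in> \<sigma> v ` (out_arcs E v \<times> UNIV)"
        using bij_betw_imp_surj_on[OF bij[OF real_ghost(2)]] real_ghost(3) by simp
      then obtain e n where e: "e \<in> arcs E" "tail E e = v" "\<sigma> v (e, n) = (m, i)"
        by auto
      have "act (real_gen w e' i * ghost_gen w e' j) f x
          = (if e' = e then if i = j then f x else 0 else 0)" if e': "e' \<in> out_arcs E v" for e'
      proof (cases "e' = e")
        case True
        then show ?thesis
          using e act_real_eq[OF e(1), of n m i] by (simp add: act_mult x act_ghost)
      next
        case False
        then have "\<sigma> (tail E e') (e', n') \<noteq> (m, i)" for n'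
          using inj[of e n e' n'] e e' by auto
        then show ?thesis
          using e' False by (simp add: act_mult act_real x)
      qed
      moreover have "finite (out_arcs E v)" "e \<in> out_arcs E v"
        using real_ghost(2) e by (simp_all add: regular_verts_def)
      ultimately show ?thesis
        by (simp add: real_ghost(1) act_diff act_sum act_vertex act_zero x)
    qed
  next
    case (ghost_real v e g)
    then have eg: "e \<in> arcs E" "g \<in> arcs E" "tail E e = v" "tail E g = v" by auto
    show ?thesis
    proof (cases "fst x = head E e")
      case False
      then show ?thesis
        using eg by (auto simp: ghost_real(1) act_diff act_sum act_vertex act_zero act_mult act_ghost)
    next
      case True
      obtain n where x: "x = (head E e, n)" using True by (cases x) auto
      \<comment> \<open>Dually, \<open>e_i^*\<close> is nonzero at \<open>(r(e), n)\<close> only for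
        the single row \<open>i = j\<close>, leading to \<open>(v, m)\<close>. From there
        \<open>g_j\<close> is nonzero only if \<open>g = e\<close>, and then it returns to
        \<open>(r(e), n)\<close>.\<close>
      obtain m j where mj: "\<sigma> v (e, n) = (m, j)" by fastforce
      have j: "j \<in> {1..vertex_weight E w v}"
        using bspec[OF bij_betwE[OF bij[OF ghost_real(2)]], of "(e, n)"] ghost_real(3) mj by simp
      have "act (ghost_gen w e i * real_gen w g i) f x
          = (if i = j then act (real_gen w g j) f (v, m) else 0)" for i
        using eg mj by (simp add: act_mult act_ghost x)
      moreover have "act (real_gen w g j) f (v, m) = (if e = g then f x else 0)"
      proof (cases "e = g")
        case True
        then show ?thesis
          using act_real_eq[OF eg(2), of n m j] eg mj x by simp
      next
        case False
        then have "\<sigma> (tail E g) (g, n') \<noteq> (m, j)" for n'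
          using inj[of e n g n'] eg mj by auto
        then show ?thesis using False eg by (simp add: act_real)
      qed
      ultimately show ?thesis
        using j by (simp add: ghost_real(1) act_diff act_sum act_vertex act_zero x)
    qed
  qed
  then have "wlpa_relators E w \<subseteq> J"
    using wlpa_relators_carrier by (auto simp: J_def)
  then have "wlpa_relation_ideal E w \<subseteq> J"
    unfolding wlpa_relation_ideal_def J_def act_def
    by (intro ideal_generated_minimal alg_ideal_annihilator)
  \<comment> \<open>On the constant function 1 the projection has value 1 at every point over
    \<open>v\<close>.\<close>
  moreover have "act (vertex_gen v) (\<lambda>x. 1) \<noteq> (\<lambda>x. 0)"
    by (auto simp: act_vertex fun_eq_iff)
  then have "vertex_gen v \<notin> J"
    unfolding J_def by auto
  ultimately show ?thesis by blast
qed

end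

section \<open>The quotient graph\<close>

context row_finite_weighted_graph
begin

context
  fixes H :: "'v set"
  assumes hereditary: "hereditary E H" and saturated: "saturated E w H"
begin

text \<open>By heredity an arc whose range avoids \<open>H\<close> also has its source outside
  \<open>H\<close>.\<close>

lemma quotient_arcs: "arcs (quotient_graph E H) = {e \<in> arcs E. tail E e \<notin> H \<and> head E e \<notin> H}"
  using hereditary by (auto simp: quotient_graph_def hereditary_def)

lemma quotient_letters_subset: "wlpa_letters (quotient_graph E H) w \<subseteq> wlpa_letters E w"
  by (auto simp: wlpa_letters_def quotient_graph_def)

lemma quotient_out_arcs:
  "out_arcs (quotient_graph E H) v = {e \<in> out_arcs E v. head E e \<notin> H}"
  by (auto simp: out_arcs_def quotient_graph_def)

text \<open>Saturation is applied with \<open>i\<close> the maximal weight at \<open>v\<close>: if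
  all arcs of that weight ended in \<open>H\<close>, then \<open>v\<close> would lie in
  \<open>H\<close>.\<close>

lemma exists_surviving_arc:
  assumes "v \<in> regular_verts E" "v \<notin> H"
  shows "\<exists>e\<in>out_arcs (quotient_graph E H) v. w e = vertex_weight E w v"
proof -
  have fin: "finite (out_arcs E v)" "out_arcs E v \<noteq> {}"
    using assms(1) by (auto simp: regular_verts_def)
  then have "vertex_weight E w v \<in> w ` out_arcs E v"
    unfolding vertex_weight_def by (intro Max_in) auto
  \<comment> \<open>The index is admissible for saturation because weights are positive.\<close>
  then have "vertex_weight E w v \<in> {1..vertex_weight E w v}"
    using weight_pos by fastforce
  then have "\<not> head E ` arcs_of_weight_ge E w v (vertex_weight E w v) \<subseteq> H"
    using saturated assms by (auto simp: saturated_def)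
  then obtain e where e: "e \<in> out_arcs E v" "vertex_weight E w v \<le> w e" "head E e \<notin> H"
    by (auto simp: arcs_of_weight_ge_def)
  moreover have "w e \<le> vertex_weight E w v"
    unfolding vertex_weight_def using fin e(1) by simp
  ultimately show ?thesis
    by (auto simp: quotient_out_arcs)
qed

lemma quotient_regular_verts: "regular_verts (quotient_graph E H) = regular_verts E - H"
proof -
  have "out_arcs E v \<noteq> {}" "finite (out_arcs E v)"
    if "v \<in> verts E" "out_arcs (quotient_graph E H) v \<noteq> {}" for v
    using that row_finite by (auto simp: quotient_out_arcs)
  moreover have "out_arcs (quotient_graph E H) v \<noteq> {}" "finite (out_arcs (quotient_graph E H) v)"
    if "v \<in> regular_verts E" "v \<notin> H" for v
    using that exists_surviving_arc[OF that]
    by (auto simp: quotient_out_arcs regular_verts_def simp del: in_out_arcs_conv)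
  moreover have "verts (quotient_graph E H) = verts E - H"
    by (simp add: quotient_graph_def)
  ultimately show ?thesis
    unfolding regular_verts_def by blast
qed

text \<open>The surviving arc attains the old maximum. Consequently the relations at
  \<open>v\<close> run over the same indices for \<open>E\<close> and for
  \<open>E/H\<close>.\<close>

lemma quotient_vertex_weight:
  assumes "v \<in> regular_verts E" "v \<notin> H"
  shows "vertex_weight (quotient_graph E H) w v = vertex_weight E w v"
proof -
  have fin: "finite (out_arcs E v)"
    using assms(1) by (simp add: regular_verts_def)
  obtain e where e: "e \<in> out_arcs (quotient_graph E H) v" "w e = vertex_weight E w v"
    using exists_surviving_arc[OF assms] by blast
  show ?thesis
    unfolding vertex_weight_def[of "quotient_graph E H"]
  proof (rule Max_eqI)
    show "finite (w ` out_arcs (quotient_graph E H) v)"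
      using fin by (simp add: quotient_out_arcs del: in_out_arcs_conv)
    show "y \<le> vertex_weight E w v" if "y \<in> w ` out_arcs (quotient_graph E H) v" for y
      using that fin by (auto simp: quotient_out_arcs vertex_weight_def)
    show "vertex_weight E w v \<in> w ` out_arcs (quotient_graph E H) v"
      using e by force
  qed
qed

section \<open>Generators and relators under restriction to the letters of the quotient
  graph\<close>

abbreviation restrict_wlpa :: "(('v, 'e) letter, 'k::field) nc_poly \<Rightarrow> (('v, 'e) letter, 'k) nc_poly"
  where "restrict_wlpa \<equiv> restrict_letters (wlpa_letters (quotient_graph E H) w)"

lemma restrict_vertex_gen:
  assumes "v \<in> verts E"
  shows "restrict_wlpa (vertex_gen v) = (if v \<in> H then 0 else vertex_gen v)"
  using assms
  by (auto simp: vertex_gen_def restrict_letters_gen wlpa_letters_def quotient_graph_def)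

lemma restrict_real_gen:
  assumes "e \<in> arcs E"
  shows "restrict_wlpa (real_gen w e i) = (if head E e \<in> H then 0 else real_gen w e i)"
  using assms
  by (auto simp: real_gen_def restrict_letters_gen restrict_letters_zero wlpa_letters_def
      quotient_graph_def)

lemma restrict_ghost_gen:
  assumes "e \<in> arcs E"
  shows "restrict_wlpa (ghost_gen w e i) = (if head E e \<in> H then 0 else ghost_gen w e i)"
  using assms
  by (auto simp: ghost_gen_def restrict_letters_gen restrict_letters_zero wlpa_letters_def
      quotient_graph_def)

text \<open>The summands of arcs into \<open>H\<close> are killed, and the arcs left over are those
  that \<open>v\<close> emits in the quotient graph.\<close>

lemma restrict_sum_out_arcs:
  assumes "v \<in> verts E"
  shows "restrict_wlpa (\<Sum>e\<in>out_arcs E v. real_gen w e i * ghost_gen w e j)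
    = (\<Sum>e\<in>out_arcs (quotient_graph E H) v. real_gen w e i * ghost_gen w e j)"
  unfolding restrict_letters_sum
proof (rule sum.mono_neutral_cong_right[OF row_finite[OF assms]])
  show "\<forall>e\<in>out_arcs E v - out_arcs (quotient_graph E H) v.
      restrict_wlpa (real_gen w e i * ghost_gen w e j) = 0"
    by (auto simp: quotient_out_arcs restrict_letters_mult restrict_real_gen)
qed (auto simp: quotient_out_arcs restrict_letters_mult restrict_real_gen restrict_ghost_gen)

text \<open>Each relator of \<open>E/H\<close> is the restriction of the relator of \<open>E\<close>
  with the same parameters, because regular vertices outside \<open>H\<close> and their weights are
  unchanged. This is used to place the relation ideal of \<open>E/H\<close> inside the kernel of the
  map to \<open>L(E, w)/I(H)\<close>.\<close>

lemma quotient_relators: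
  "wlpa_relators (quotient_graph E H) w \<subseteq>
     restrict_wlpa ` (wlpa_relators E w :: (('v, 'e) letter, 'k::field) nc_poly set)"
  (is "?R \<subseteq> restrict_wlpa ` ?S")
proof
  have imageI': "p \<in> restrict_wlpa ` ?S" if "restrict_wlpa q = p" "q \<in> ?S" for p q
    using that by blast
  note restrict = restrict_letters_diff restrict_letters_mult restrict_letters_sum
    restrict_letters_zero restrict_vertex_gen restrict_real_gen restrict_ghost_gen
  have graph: "verts (quotient_graph E H) = verts E - H" "tail (quotient_graph E H) = tail E"
    "head (quotient_graph E H) = head E"
    by (simp_all add: quotient_graph_def)
  fix p assume "p \<in> ?R"
  then show "p \<in> restrict_wlpa ` ?S"
  proof cases
    case (vertices u v)
    show ?thesis
      by (rule imageI'[OF _ wlpa_relators.vertices[of u E v]])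
        (use vertices in \<open>auto simp: restrict graph\<close>)
  next
    case (real_source e i)
    show ?thesis
      by (rule imageI'[OF _ wlpa_relators.real_source[of e E i]])
        (use real_source in \<open>auto simp: restrict graph quotient_arcs\<close>)
  next
    case (real_range e i)
    show ?thesis
      by (rule imageI'[OF _ wlpa_relators.real_range[of e E i]])
        (use real_range in \<open>auto simp: restrict graph quotient_arcs\<close>)
  next
    case (ghost_source e i)
    show ?thesis
      by (rule imageI'[OF _ wlpa_relators.ghost_source[of e E i]])
        (use ghost_source in \<open>auto simp: restrict graph quotient_arcs\<close>)
  next
    case (ghost_range e i)
    show ?thesis
      by (rule imageI'[OF _ wlpa_relators.ghost_range[of e E i]])
        (use ghost_range in \<open>auto simp: restrict graph quotient_arcs\<close>)
  next
    case (real_ghost v i j)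
    then have v: "v \<in> regular_verts E" "v \<notin> H" "v \<in> verts E"
      by (auto simp: quotient_regular_verts) (simp add: regular_verts_def)
    show ?thesis
      by (rule imageI'[OF _ wlpa_relators.real_ghost[of v E i w j]])
        (use real_ghost v in \<open>auto simp: restrict_letters_diff restrict_sum_out_arcs
           restrict_vertex_gen restrict_letters_zero quotient_vertex_weight\<close>)
  next
    case (ghost_real v e f)
    then have v: "v \<in> regular_verts E" "v \<notin> H"
      by (auto simp: quotient_regular_verts)
    show ?thesis
      by (rule imageI'[OF _ wlpa_relators.ghost_real[of v E e f w]])
        (use ghost_real v in \<open>auto simp: restrict graph quotient_out_arcs quotient_vertex_weight\<close>)
  qed
qed

text \<open>Relators that involve \<open>H\<close> collapse to zero and the others become relators
  of \<open>E/H\<close>. Hence restriction is compatible with the two relation ideals.\<close>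

lemma restrict_relators:
  "restrict_wlpa ` (wlpa_relators E w :: (('v, 'e) letter, 'k::field) nc_poly set) \<subseteq>
     insert 0 (wlpa_relators (quotient_graph E H) w)"
  (is "_ \<subseteq> insert 0 ?R")
proof
  note restrict = restrict_letters_diff restrict_letters_mult restrict_letters_sum
    restrict_letters_zero restrict_vertex_gen restrict_real_gen restrict_ghost_gen
  have graph: "verts (quotient_graph E H) = verts E - H" "tail (quotient_graph E H) = tail E"
    "head (quotient_graph E H) = head E"
    by (simp_all add: quotient_graph_def)
  have head_in_H: "head E e \<in> H" if "e \<in> arcs E" "tail E e \<in> H" for e
    using hereditary that by (simp add: hereditary_def)
  fix q assume "q \<in> restrict_wlpa ` (wlpa_relators E w :: (('v, 'e) letter, 'k::field) nc_poly set)"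
  then obtain p :: "(('v, 'e) letter, 'k) nc_poly"
    where q: "q = restrict_wlpa p" and p: "p \<in> wlpa_relators E w"
    by blast
  from p show "q \<in> insert 0 ?R"
  proof cases
    case (vertices u v)
    then have "q = 0" if "u \<in> H \<or> v \<in> H"
      using that by (auto simp: q restrict)
    moreover have "q \<in> ?R" if "u \<notin> H" "v \<notin> H"
      using vertices that wlpa_relators.vertices[of u "quotient_graph E H" v w]
      by (simp add: q restrict graph if_distrib[of restrict_wlpa] cong: if_cong)
    ultimately show ?thesis by blast
  next
    case (real_source e i)
    then have "q = 0" if "head E e \<in> H"
      using that by (auto simp: q restrict)
    moreover have "q \<in> ?R" if "head E e \<notin> H"
      using real_source that head_in_H wlpa_relators.real_source[of e "quotient_graph E H" i w]
      by (auto simp: q restrict graph quotient_arcs)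
    ultimately show ?thesis by blast
  next
    case (real_range e i)
    then have "q = 0" if "head E e \<in> H"
      using that by (auto simp: q restrict)
    moreover have "q \<in> ?R" if "head E e \<notin> H"
      using real_range that head_in_H wlpa_relators.real_range[of e "quotient_graph E H" i w]
      by (auto simp: q restrict graph quotient_arcs)
    ultimately show ?thesis by blast
  next
    case (ghost_source e i)
    then have "q = 0" if "head E e \<in> H"
      using that by (auto simp: q restrict)
    moreover have "q \<in> ?R" if "head E e \<notin> H"
      using ghost_source that head_in_H wlpa_relators.ghost_source[of e "quotient_graph E H" i w]
      by (auto simp: q restrict graph quotient_arcs)
    ultimately show ?thesis by blast
  next
    case (ghost_range e i)
    then have "q = 0" if "head E e \<in> H"
      using that by (auto simp: q restrict)
    moreover have "q \<in> ?R" if "head E e \<notin> H"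
      using ghost_range that head_in_H wlpa_relators.ghost_range[of e "quotient_graph E H" i w]
      by (auto simp: q restrict graph quotient_arcs)
    ultimately show ?thesis by blast
  next
    case (real_ghost v i j)
    then have v: "v \<in> verts E" by (simp add: regular_verts_def)
    then have q': "q = (\<Sum>e\<in>out_arcs (quotient_graph E H) v. real_gen w e i * ghost_gen w e j)
        - (if i = j then if v \<in> H then 0 else vertex_gen v else 0)"
      using real_ghost by (simp add: q restrict_letters_diff restrict_sum_out_arcs
          restrict_vertex_gen restrict_letters_zero)
    \<comment> \<open>By heredity every arc out of \<open>v\<close> ends in \<open>H\<close>, so the
      sum becomes empty while \<open>v\<close> itself is killed.\<close>
    have "q = 0" if "v \<in> H"
    proof -
      have "out_arcs (quotient_graph E H) v = {}"
        using head_in_H that by (auto simp: quotient_out_arcs)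
      with that show ?thesis by (simp add: q')
    qed
    moreover have "q \<in> ?R" if "v \<notin> H"
      unfolding q' if_not_P[OF that] using that real_ghost(2-4)
      by (intro wlpa_relators.real_ghost) (simp_all add: quotient_regular_verts quotient_vertex_weight)
    ultimately show ?thesis by blast
  next
    case (ghost_real v e f)
    then have ef: "e \<in> arcs E" "f \<in> arcs E" "tail E e = v" "tail E f = v" by auto
    \<comment> \<open>Every product has a killed factor, and if \<open>e = f\<close>, the range
      vertex is killed as well.\<close>
    have "q = 0" if "head E e \<in> H \<or> head E f \<in> H"
      using ef that by (auto simp: q ghost_real(1) restrict)
    moreover have "q \<in> ?R" if "head E e \<notin> H" "head E f \<notin> H"
    proof -
      have "v \<notin> H" using ef that head_in_H by auto
      have "q = p"
        using ef that by (auto simp: q ghost_real(1) restrict)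
      moreover have "(\<Sum>i\<in>{1..vertex_weight (quotient_graph E H) w v}.
          ghost_gen w e i * real_gen w f i)
        - (if e = f then vertex_gen (head (quotient_graph E H) e) else 0) \<in> ?R"
        using \<open>v \<notin> H\<close> that ghost_real(2-4)
        by (intro wlpa_relators.ghost_real) (simp_all add: quotient_regular_verts quotient_out_arcs)
      ultimately show ?thesis
        using quotient_vertex_weight[OF ghost_real(2) \<open>v \<notin> H\<close>] ghost_real(1) by (simp only: graph)
    qed
    ultimately show ?thesis by blast
  qed
qed

text \<open>Besides the vertices in \<open>H\<close>, the missing letters are \<open>e_i\<close> and
  \<open>e_i^*\<close> with \<open>r(e)\<close> in \<open>H\<close>. Modulo the relations these
  equal \<open>e_i r(e)\<close> and \<open>r(e) e_i^*\<close>, multiples of a vertex in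
  \<open>H\<close>.\<close>

lemma removed_letters_in_ideal:
  assumes ideal: "alg_ideal (free_algebra (wlpa_letters E w)) K"
    and relators: "wlpa_relators E w \<subseteq> K" and vertices: "vertex_gen ` H \<subseteq> K"
    and x: "x \<in> wlpa_letters E w - wlpa_letters (quotient_graph E H) w"
  shows "gen x \<in> (K :: (('v, 'e) letter, 'k::field) nc_poly set)"
proof -
  interpret F: nu_algebra_ideal "free_algebra (wlpa_letters E w)" K
    by (intro nu_algebra_ideal.intro nu_algebra_ideal_axioms.intro free_algebra_nu_algebra ideal)
  note add = F.ideal_add[unfolded free_algebra_ops]
    and left = F.ideal_mult_left[unfolded free_algebra_ops]
    and right = F.ideal_mult_right[unfolded free_algebra_ops]
  have diff: "a \<in> K" if "b - a \<in> K" "b \<in> K" for a b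
    using add[OF F.ideal_smult[OF that(1), of "- 1", unfolded free_algebra_ops] that(2)]
    by (simp add: single_uminus)
  have carrier: "gen x \<in> alg_carrier (free_algebra (wlpa_letters E w))"
    using x by (auto simp: gen_def free_algebra_def)
  consider (vertex) v where "v \<in> H" "x = Vertex v"
    | (real) e i where "e \<in> arcs E" "i \<in> {1..w e}" "head E e \<in> H" "x = Real_Edge e i"
    | (ghost) e i where "e \<in> arcs E" "i \<in> {1..w e}" "head E e \<in> H" "x = Ghost_Edge e i"
    using x by (auto simp: wlpa_letters_def quotient_graph_def image_iff) blast
  then show ?thesis
  proof cases
    case vertex
    then show ?thesis using vertices by (auto simp: vertex_gen_def)
  next
    case real
    then have "real_gen w e i * vertex_gen (head E e) - real_gen w e i \<in> K"
      using relators wlpa_relators.real_range[of e E i w] by blast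
    moreover have "gen x * vertex_gen (head E e) \<in> K"
      using left[OF carrier] vertices real by blast
    ultimately show ?thesis
      using real diff by (simp add: real_gen_def)
  next
    case ghost
    then have "vertex_gen (head E e) * ghost_gen w e i - ghost_gen w e i \<in> K"
      using relators wlpa_relators.ghost_source[of e E i w] by blast
    moreover have "vertex_gen (head E e) * gen x \<in> K"
      using right[OF _ carrier] vertices ghost by blast
    ultimately show ?thesis
      using ghost diff by (simp add: ghost_gen_def)
  qed
qed

end

end

section \<open>Comparison of the two kernels\<close>

theorem theorem2p10:
  fixes E :: "('v, 'e) pre_digraph" and w :: "'e \<Rightarrow> nat" and H :: "'v set"
  assumes "row_finite_weighted_graph E w"
    and "hereditary E H"
    and "saturated E w H"
  shows "(\<exists>\<phi>. algebra_iso
              (quotient_algebra (wlpa E w) (vertex_ideal E w H))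
              (wlpa (quotient_graph E H) w :: ('k::field, ('v, 'e, 'k) wlpa_elem) nu_algebra) \<phi>) \<and>
         {v \<in> verts E. wlpa_vertex E w v \<in> (vertex_ideal E w H :: ('v, 'e, 'k) wlpa_elem set)} = H"
proof -
  interpret row_finite_weighted_graph E w by fact
  interpret Q: row_finite_weighted_graph "quotient_graph E H" w
    by (rule quotient_graph_row_finite_weighted_graph) fact+
  have H: "H \<subseteq> verts E"
    using assms(2) by (simp add: hereditary_def)
  let ?X = "wlpa_letters E w" and ?Y = "wlpa_letters (quotient_graph E H) w"
  define FE :: "('k, (('v, 'e) letter, 'k) nc_poly) nu_algebra" where "FE = free_algebra ?X"
  define FQ :: "('k, (('v, 'e) letter, 'k) nc_poly) nu_algebra" where "FQ = free_algebra ?Y"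
  define RE :: "(('v, 'e) letter, 'k) nc_poly set" where "RE = wlpa_relation_ideal E w"
  define RQ :: "(('v, 'e) letter, 'k) nc_poly set" where "RQ = wlpa_relation_ideal (quotient_graph E H) w"
  define LE :: "('k, ('v, 'e, 'k) wlpa_elem) nu_algebra" where "LE = wlpa E w"
  define LQ :: "('k, ('v, 'e, 'k) wlpa_elem) nu_algebra" where "LQ = wlpa (quotient_graph E H) w"
  define I :: "('v, 'e, 'k) wlpa_elem set" where "I = vertex_ideal E w H"
  interpret FE: nu_algebra_ideal FE RE
    unfolding FE_def RE_def by (rule wlpa_nu_algebra_ideal)
  interpret FQ: nu_algebra_ideal FQ RQ
    unfolding FQ_def RQ_def by (rule Q.wlpa_nu_algebra_ideal)
  interpret LE: nu_algebra_ideal LE I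
    unfolding LE_def I_def by (rule vertex_nu_algebra_ideal[OF H])
  have LE: "LE = quotient_algebra FE RE" and LQ: "LQ = quotient_algebra FQ RQ"
    by (simp_all add: LE_def LQ_def FE_def FQ_def RE_def RQ_def wlpa_def)
  have sub: "?Y \<subseteq> ?X"
    using quotient_letters_subset[OF assms(2,3)] .
  have carr_sub: "alg_carrier FQ \<subseteq> alg_carrier FE"
    unfolding FE_def FQ_def by (rule free_algebra_mono[OF sub])
  let ?f = "\<lambda>p. coset LE I (coset FE RE p)"
  let ?\<rho> = "restrict_letters ?Y :: (('v, 'e) letter, 'k) nc_poly \<Rightarrow> _"
  let ?g = "\<lambda>p. coset FQ RQ (?\<rho> p)"
  have \<rho>: "algebra_hom FE FQ ?\<rho>"
    unfolding FE_def FQ_def by (rule restrict_letters_hom)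
  have coset_hom: "algebra_hom FE LE (coset FE RE)"
    unfolding LE by (rule FE.algebra_hom_coset)
  have f: "algebra_hom FE (quotient_algebra LE I) ?f"
    by (rule algebra_hom_comp[OF coset_hom LE.algebra_hom_coset])
  have g: "algebra_hom FE LQ ?g"
    unfolding LQ by (rule algebra_hom_comp[OF \<rho> FQ.algebra_hom_coset])
  have coset_surj: "coset FE RE ` alg_carrier FE = alg_carrier LE"
    unfolding LE by (rule FE.coset_image_carrier)
  have f_surj: "?f ` alg_carrier FE = alg_carrier (quotient_algebra LE I)"
    using LE.coset_image_carrier coset_surj by (metis image_image)
  have "?\<rho> ` alg_carrier FE = alg_carrier FQ"
    unfolding FE_def FQ_def by (rule restrict_letters_image[OF sub])
  then have g_surj: "?g ` alg_carrier FE = alg_carrier LQ"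
    unfolding LQ using FQ.coset_image_carrier by (metis image_image)
  have LQ_alg: "nu_algebra LQ"
    unfolding LQ by (rule FQ.quotient_nu_algebra)
  \<comment> \<open>Both claims follow from \<open>K = J\<close>: the first from the induced
    isomorphism, the second by testing membership of vertices in \<open>J\<close> instead of
    \<open>K\<close>.\<close>
  define K where "K = alg_kernel FE (quotient_algebra LE I) ?f"
  define J where "J = alg_kernel FE LQ ?g"
  have K_ideal: "alg_ideal FE K"
    unfolding K_def by (rule alg_ideal_kernel[OF FE.nu_algebra_axioms LE.quotient_nu_algebra f])
  have J_ideal: "alg_ideal FE J"
    unfolding J_def by (rule alg_ideal_kernel[OF FE.nu_algebra_axioms LQ_alg g])
  have K: "p \<in> K \<longleftrightarrow> coset FE RE p \<in> I" if "p \<in> alg_carrier FE" for p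
    using that coset_surj LE.coset_eq_zero_iff[of "coset FE RE p"] by (auto simp: K_def alg_kernel_def)
  have \<rho>_carrier: "?\<rho> p \<in> alg_carrier FQ" if "p \<in> alg_carrier FE" for p
    using \<rho> that unfolding algebra_hom_def by blast
  have J: "p \<in> J \<longleftrightarrow> ?\<rho> p \<in> RQ" if "p \<in> alg_carrier FE" for p
    using that FQ.coset_eq_zero_iff[OF \<rho>_carrier[OF that]] by (simp add: J_def alg_kernel_def LQ)
  have vertex_carrier: "vertex_gen v \<in> alg_carrier FE" if "v \<in> verts E" for v
    unfolding FE_def by (rule vertex_gen_carrier[OF that])
  have coset_vertex: "coset FE RE (vertex_gen v) = wlpa_vertex E w v" for v
    by (simp add: FE_def RE_def wlpa_vertex_def)
  have H_K: "vertex_gen ` H \<subseteq> K"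
  proof
    fix p :: "(('v, 'e) letter, 'k) nc_poly"
    assume "p \<in> vertex_gen ` H"
    then obtain v where v: "v \<in> H" "p = vertex_gen v" by blast
    have "wlpa_vertex E w v \<in> I"
      unfolding I_def vertex_ideal_def
      by (rule subsetD[OF ideal_generated_superset imageI[OF v(1)]])
    then show "p \<in> K"
      using v H K[OF vertex_carrier] unfolding coset_vertex by blast
  qed
  have relators_RE: "wlpa_relators E w \<subseteq> RE"
    unfolding RE_def wlpa_relation_ideal_def by (rule ideal_generated_superset)
  have relators_RQ: "wlpa_relators (quotient_graph E H) w \<subseteq> RQ"
    unfolding RQ_def wlpa_relation_ideal_def by (rule ideal_generated_superset)
  have "p \<in> K" if "p \<in> RE" for p
    using K[OF FE.ideal_carrier[OF that]] FE.coset_eq_zero_iff[OF FE.ideal_carrier[OF that]] that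
      LE.ideal_zero by (simp add: LE)
  then have RE_K: "RE \<subseteq> K" by blast
  have relators_J: "wlpa_relators E w \<subseteq> J"
  proof
    fix p :: "(('v, 'e) letter, 'k) nc_poly" assume p: "p \<in> wlpa_relators E w"
    then have "?\<rho> p \<in> insert 0 (wlpa_relators (quotient_graph E H) w)"
      using restrict_relators[OF assms(2,3)] by blast
    then have "?\<rho> p \<in> RQ"
      using relators_RQ FQ.ideal_zero by (auto simp: FQ_def free_algebra_ops)
    then show "p \<in> J"
      using J p relators_RE FE.ideal_carrier by blast
  qed
  then have RE_J: "RE \<subseteq> J"
    using J_ideal unfolding RE_def wlpa_relation_ideal_def FE_def
    by (rule ideal_generated_minimal[rotated])
  have H_J: "vertex_gen ` H \<subseteq> J"
  proof
    fix p :: "(('v, 'e) letter, 'k) nc_poly"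
    assume "p \<in> vertex_gen ` H"
    then obtain v where v: "v \<in> H" "p = vertex_gen v" by blast
    then have "v \<in> verts E" using H by blast
    with v have "?\<rho> p = 0" "p \<in> alg_carrier FE"
      by (simp_all add: restrict_vertex_gen[OF assms(2,3)] vertex_carrier)
    then show "p \<in> J"
      using J[of p] FQ.ideal_zero by (simp add: FQ_def free_algebra_ops)
  qed
  \<comment> \<open>The image of \<open>J\<close> in \<open>L(E, w)\<close> is an ideal containing
    the vertices of \<open>H\<close>, hence contains \<open>I\<close>. An element of
    \<open>K\<close> therefore agrees with some element of \<open>J\<close> up to \<open>RE\<close>,
    and \<open>RE\<close> lies in \<open>J\<close>.\<close>
  have "K \<subseteq> J"
  proof
    fix p assume p: "p \<in> K"
    then have carr: "p \<in> alg_carrier FE" by (simp add: K_def alg_kernel_def)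
    have "alg_ideal LE (coset FE RE ` J)"
      by (rule alg_ideal_surjective_image[OF coset_hom coset_surj FE.nu_algebra_axioms
            LE.nu_algebra_axioms J_ideal])
    moreover have "wlpa_vertex E w ` H \<subseteq> coset FE RE ` J"
      using H_J by (force simp: coset_vertex[symmetric])
    ultimately have "I \<subseteq> coset FE RE ` J"
      unfolding I_def vertex_ideal_def LE_def by (rule ideal_generated_minimal)
    then obtain q where q: "q \<in> J" "coset FE RE p = coset FE RE q"
      using p K[OF carr] by blast
    then have "p \<in> coset FE RE q"
      using FE.coset_self[OF carr] by simp
    then obtain r where "r \<in> RE" "p = alg_add FE q r"
      by (auto simp: coset_def)
    then show "p \<in> J"
      using q(1) RE_J J_ideal by (auto simp: alg_ideal_def)
  qed
  \<comment> \<open>Modulo \<open>K\<close> every element equals its restriction, since the removed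
    letters lie in \<open>K\<close>. For \<open>p\<close> in \<open>J\<close> the restriction lies
    in \<open>RQ\<close>, so it remains to see that \<open>RQ\<close> is contained in
    \<open>K\<close>.\<close>
  moreover have "J \<subseteq> K"
  proof
    fix p assume p: "p \<in> J"
    then have carr: "p \<in> alg_carrier FE" by (simp add: J_def alg_kernel_def)
    interpret K: nu_algebra_ideal FE K
      by unfold_locales (rule K_ideal)
    have diff: "q - ?\<rho> q \<in> K" if "q \<in> alg_carrier FE" for q
      using that K_ideal unfolding FE_def
    proof (intro diff_restrict_letters_in_ideal)
      show "gen x \<in> K" if "x \<in> ?X - ?Y" for x
        using removed_letters_in_ideal[OF assms(2,3) K_ideal[unfolded FE_def] _ H_K that]
          relators_RE RE_K by blast
    qed
    have sum: "a + b \<in> K" if "a \<in> K" "b \<in> K" for a b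
      using K.ideal_add[OF that] by (simp add: FE_def free_algebra_ops)
    have neg: "- a \<in> K" if "a \<in> K" for a
      using K.ideal_smult[OF that, of "- 1"] by (simp add: FE_def free_algebra_ops single_uminus)
    have "wlpa_relators (quotient_graph E H) w \<subseteq> K \<inter> alg_carrier FQ"
    proof
      fix q :: "(('v, 'e) letter, 'k) nc_poly"
      assume q: "q \<in> wlpa_relators (quotient_graph E H) w"
      then obtain r where r: "r \<in> wlpa_relators E w" "q = ?\<rho> r"
        using quotient_relators[OF assms(2,3)] by blast
      then have "r \<in> K" using relators_RE RE_K by blast
      \<comment> \<open>A relator \<open>q\<close> of \<open>E/H\<close> is the restriction of a
        relator \<open>r\<close> of \<open>E\<close>, and differs from \<open>r\<close> by an
        element of \<open>K\<close>.\<close>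
      with r diff[of r] have "r + - (r - q) \<in> K"
        using sum neg K.ideal_carrier by blast
      then show "q \<in> K \<inter> alg_carrier FQ"
        using q relators_RQ FQ.ideal_carrier by auto
    qed
    \<comment> \<open>\<open>RQ\<close> is generated as an ideal of the smaller free algebra, so
      minimality is applied to the trace of \<open>K\<close> there.\<close>
    moreover have "alg_ideal FQ (K \<inter> alg_carrier FQ)"
    proof -
      have ops: "alg_zero FQ = alg_zero FE" "alg_add FQ = alg_add FE" "alg_mult FQ = alg_mult FE"
        "alg_smult FQ = alg_smult FE"
        by (simp_all add: FE_def FQ_def free_algebra_ops)
      show ?thesis
        using K.ideal carr_sub FQ.zero_closed FQ.add_closed FQ.mult_closed FQ.smult_closed
        unfolding alg_ideal_def ops by (auto simp: subset_iff)
    qed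
    ultimately have "RQ \<subseteq> K \<inter> alg_carrier FQ"
      unfolding RQ_def wlpa_relation_ideal_def FQ_def by (rule ideal_generated_minimal[rotated])
    then have "?\<rho> p \<in> K" using J[OF carr] p by blast
    then show "p \<in> K" using sum[OF diff[OF carr]] by force
  qed
  ultimately have "K = J" by blast
  then have "\<exists>\<phi>. algebra_iso (quotient_algebra LE I) LQ \<phi>"
    unfolding K_def J_def
    by (rule isomorphic_if_kernels_eq[OF FE.nu_algebra_axioms LE.quotient_nu_algebra LQ_alg
          f f_surj g g_surj])
  moreover have "wlpa_vertex E w v \<in> I \<longleftrightarrow> v \<in> H" if v: "v \<in> verts E" for v
  proof -
    have "wlpa_vertex E w v \<in> I \<longleftrightarrow> vertex_gen v \<in> K"
      using K[OF vertex_carrier[OF v]] coset_vertex by simp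
    also have "\<dots> \<longleftrightarrow> ?\<rho> (vertex_gen v) \<in> RQ"
      using J[OF vertex_carrier[OF v]] \<open>K = J\<close> by simp
    \<comment> \<open>A vertex in \<open>H\<close> restricts to zero. A vertex outside
      \<open>H\<close> restricts to itself, which is nonzero in the algebra of
      \<open>E/H\<close>.\<close>
    also have "\<dots> \<longleftrightarrow> v \<in> H"
    proof (cases "v \<in> H")
      case True
      then show ?thesis
        using FQ.ideal_zero
        by (simp add: FQ_def free_algebra_ops restrict_vertex_gen[OF assms(2,3) v])
    next
      case False
      then have "v \<in> verts (quotient_graph E H)"
        using v by (simp add: quotient_graph_def)
      then show ?thesis
        using False
        by (simp add: RQ_def Q.vertex_gen_notin_relation_ideal restrict_vertex_gen[OF assms(2,3) v])
    qed
    finally show ?thesis .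
  qed
  then have "{v \<in> verts E. wlpa_vertex E w v \<in> I} = H"
    using H by blast
  ultimately show ?thesis
    unfolding LE_def LQ_def I_def by blast
qed

end
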